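(* Let $M$ be a compact, smooth, orientable, weakly pseudoconvex CR manifold of real dimension $2n-1$ embedded in $\mathbb C^N$, $N\ge n$, and endowed with the induced CR structure. If $\lambda$ is a smooth strongly plurisubharmonic function on $\mathbb C^N$, then $\lambda$ is strongly CR plurisubharmonic on $M$.
   Context: $M\subset\mathbb C^N$ is a smooth submanifold of real dimension $2n-1$ such that $T^{1,0}M=\mathbb CTM\cap T^{1,0}\mathbb C^N$ has complex rank $n-1$ (the induced CR structure); $T^{0,1}M=\overline{T^{1,0}M}$. $\gamma$ is a global purely imaginary 1-form annihilating $T^{1,0}M\oplus T^{0,1}M$, normalized by $\langle\gamma,T\rangle=-1$, where $T$ is a vector field with $\overline T=-T$ completing $T^{1,0}M\oplus T^{0,1}M$ to $\mathbb CTM$. The Levi form is $\langle d\gamma,L\wedge\overline{L'}\rangle$ for $L,L'\in T^{1,0}M$. $M$ is weakly pseudoconvex if such a global $\gamma$ exists with positive semi-definite Levi form at all points; this $\gamma$ is used below. $\bar\partial_b$ is the tangential Cauchy–Riemann operator and $\partial_b$ its conjugate; with a local orthonormal frame $L_1,\dots,L_{n-1}$ of $T^{1,0}M$ and dual forms $\omega_i$ (annihilating $T^{0,1}M$ and the orthogonal complement of $T^{1,0}M\oplus T^{0,1}M$), $\partial_b\lambda=\sum L_i(\lambda)\omega_i$, $\bar\partial_b\lambda=\sum\bar L_i(\lambda)\bar\omega_i$, and on 1-forms $\partial_b$, $\bar\partial_b$ are the corresponding type components of $d$. A smooth real-valued function $\lambda$ defined in a neighborhood of $M$ is strongly CR plurisubharmonic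 if there is a constant $A_0>0$ such that $\langle\frac12(\partial_b\bar\partial_b\lambda-\bar\partial_b\partial_b\lambda)+A_0\,d\gamma,\ L\wedge\overline L\rangle$ is positive definite as a Hermitian form in $L\in T^{1,0}M$ at every point of $M$. *)

theory Defs
  imports "HOL-Analysis.Analysis"
begin

section \<open>Smooth maps and embedded submanifolds\<close>

text \<open>Only meaningful for open \<open>U\<close>.\<close>

primrec Ck_on :: "nat \<Rightarrow> 'a::real_normed_vector set \<Rightarrow> ('a \<Rightarrow> 'b::real_normed_vector) \<Rightarrow> bool" where
  "Ck_on 0 U f \<longleftrightarrow> continuous_on U f"
| "Ck_on (Suc k) U f \<longleftrightarrow>
     (\<forall>x\<in>U. f differentiable (at x)) \<and>
     (\<forall>v. Ck_on k U (\<lambda>x. frechet_derivative f (at x) v))"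

definition smooth_on :: "'a::real_normed_vector set \<Rightarrow> ('a \<Rightarrow> 'b::real_normed_vector) \<Rightarrow> bool" where
  "smooth_on U f \<longleftrightarrow> (\<forall>k. Ck_on k U f)"

abbreviation D :: "('a::real_normed_vector \<Rightarrow> 'b::real_normed_vector) \<Rightarrow> 'a \<Rightarrow> 'a \<Rightarrow> 'b" where
  "D f x \<equiv> frechet_derivative f (at x)"

definition local_parametrization ::
    "'a::euclidean_space set \<Rightarrow> (real^'d) set \<Rightarrow> (real^'d \<Rightarrow> 'a) \<Rightarrow> bool" where
  "local_parametrization M U \<phi> \<longleftrightarrow>
     open U \<and> smooth_on U \<phi> \<and> (\<forall>u\<in>U. inj (D \<phi> u)) \<and>
     openin (top_of_set M) (\<phi> ` U) \<and> (\<exists>\<psi>. homeomorphism U (\<phi> ` U) \<phi> \<psi>)"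

text \<open>The dimension of a submanifold is \<open>CARD('d)\<close>. As the type \<open>'d\<close> does not occur in the type
  of the set \<open>M\<close>, it is passed as an explicit argument \<open>TYPE('d)\<close>.\<close>

definition smooth_submanifold :: "'d::finite itself \<Rightarrow> 'a::euclidean_space set \<Rightarrow> bool" where
  "smooth_submanifold d M \<longleftrightarrow>
     (\<forall>p\<in>M. \<exists>U (\<phi> :: real^'d \<Rightarrow> 'a). local_parametrization M U \<phi> \<and> p \<in> \<phi> ` U)"

definition orientable :: "'d::finite itself \<Rightarrow> 'a::euclidean_space set \<Rightarrow> bool" where
  "orientable d M \<longleftrightarrow>
     (\<exists>A :: ((real^'d) set \<times> (real^'d \<Rightarrow> 'a)) set.
        (\<forall>(U, \<phi>)\<in>A. local_parametrization M U \<phi>) \<and>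
        M \<subseteq> (\<Union>(U, \<phi>)\<in>A. \<phi> ` U) \<and>
        (\<forall>(U, \<phi>)\<in>A. \<forall>(V, \<psi>)\<in>A. \<forall>u\<in>U. \<phi> u \<in> \<psi> ` V \<longrightarrow>
            0 < det (matrix (D (inv_into V \<psi> \<circ> \<phi>) u))))"

definition tangent_space ::
    "'d::finite itself \<Rightarrow> 'a::euclidean_space set \<Rightarrow> 'a \<Rightarrow> 'a set" where
  "tangent_space d M p =
     {v. \<exists>U (\<phi> :: real^'d \<Rightarrow> 'a). \<exists>u\<in>U. local_parametrization M U \<phi> \<and> \<phi> u = p \<and> v \<in> range (D \<phi> u)}"


section \<open>Complexified tangent vectors\<close>

text \<open>A pair \<open>(X, Y)\<close> of real tangent vectors stands for the complexified vector \<open>X + \<i>Y\<close>.\<close>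

definition cscale :: "complex \<Rightarrow> 'a::real_vector \<times> 'a \<Rightarrow> 'a \<times> 'a" where
  "cscale c V = (Re c *\<^sub>R fst V - Im c *\<^sub>R snd V, Im c *\<^sub>R fst V + Re c *\<^sub>R snd V)"

global_interpretation cvec: vector_space "cscale :: complex \<Rightarrow> 'a::real_vector \<times> 'a \<Rightarrow> 'a \<times> 'a"
  by standard (auto simp: cscale_def algebra_simps)

definition cconj :: "'a::real_vector \<times> 'a \<Rightarrow> 'a \<times> 'a" where
  "cconj V = (fst V, - snd V)"

text \<open>Hermitian extension of the real inner product, linear in the first argument.\<close>

definition hinner :: "'a::real_inner \<times> 'a \<Rightarrow> 'a \<times> 'a \<Rightarrow> complex" where
  "hinner V W = Complex (fst V \<bullet> fst W + snd V \<bullet> snd W) (snd V \<bullet> fst W - fst V \<bullet> snd W)"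

definition clinear_on :: "('a::real_vector \<times> 'a) set \<Rightarrow> ('a \<times> 'a \<Rightarrow> complex) \<Rightarrow> bool" where
  "clinear_on S f \<longleftrightarrow>
     (\<forall>V\<in>S. \<forall>W\<in>S. f (V + W) = f V + f W) \<and> (\<forall>c. \<forall>V\<in>S. f (cscale c V) = c * f V)"

text \<open>The derivative of the function \<open>f\<close> in direction \<open>V\<close>.\<close>

definition vderiv :: "'a::real_normed_vector \<times> 'a \<Rightarrow> ('a \<Rightarrow> complex) \<Rightarrow> 'a \<Rightarrow> complex" where
  "vderiv V f p = D f p (fst V) + \<i> * D f p (snd V)"

definition CT :: "'d::finite itself \<Rightarrow> 'a::euclidean_space set \<Rightarrow> 'a \<Rightarrow> ('a \<times> 'a) set" where
  "CT d M p = tangent_space d M p \<times> tangent_space d M p"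

text \<open>The vectors of type (1,0) on complex Euclidean space are those of the form \<open>X - \<i>JX\<close>,
  where the complex structure \<open>J\<close> is multiplication of the coordinates by \<open>\<i>\<close>.\<close>

definition T10_ambient :: "((complex^'N) \<times> (complex^'N)) set" where
  "T10_ambient = {V. snd V = - (\<i> *s fst V)}"

definition T10 :: "'d::finite itself \<Rightarrow> (complex^'N) set \<Rightarrow> complex^'N \<Rightarrow> ((complex^'N) \<times> (complex^'N)) set" where
  "T10 d M p = CT d M p \<inter> T10_ambient"

definition T01 :: "'d::finite itself \<Rightarrow> (complex^'N) set \<Rightarrow> complex^'N \<Rightarrow> ((complex^'N) \<times> (complex^'N)) set" where
  "T01 d M p = cconj ` T10 d M p"

definition CR_submanifold :: "'d::finite itself \<Rightarrow> nat \<Rightarrow> (complex^'N) set \<Rightarrow> bool" where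
  "CR_submanifold d n M \<longleftrightarrow>
     CARD('d) = 2 * n - 1 \<and> smooth_submanifold d M \<and> (\<forall>p\<in>M. cvec.dim (T10 d M p) = n - 1)"


section \<open>Differential forms on a submanifold\<close>

text \<open>A 1-form on \<open>M\<close> is a function \<open>\<alpha>\<close> whose value \<open>\<alpha> p\<close> is a complex-linear functional on
  \<open>CT d M p\<close>; a 2-form is a function \<open>\<beta>\<close> with \<open>\<beta> p V W\<close> the value on \<open>V \<and> W\<close>.
  Values at other arguments are irrelevant.\<close>

type_synonym 'a form1 = "'a \<Rightarrow> 'a \<times> 'a \<Rightarrow> complex"
type_synonym 'a form2 = "'a \<Rightarrow> 'a \<times> 'a \<Rightarrow> 'a \<times> 'a \<Rightarrow> complex"

text \<open>The coefficient at \<open>b\<close> of the pullback of a 1-form.\<close>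

definition pullback :: "(real^'d \<Rightarrow> 'a::euclidean_space) \<Rightarrow> 'a form1 \<Rightarrow> real^'d \<Rightarrow> real^'d \<Rightarrow> complex" where
  "pullback \<phi> \<alpha> b u = \<alpha> (\<phi> u) (D \<phi> u b, 0)"

definition smooth_form1 :: "'d::finite itself \<Rightarrow> 'a::euclidean_space set \<Rightarrow> 'a form1 \<Rightarrow> bool" where
  "smooth_form1 d M \<alpha> \<longleftrightarrow>
     (\<forall>p\<in>M. clinear_on (CT d M p) (\<alpha> p)) \<and>
     (\<forall>U (\<phi> :: real^'d \<Rightarrow> 'a). local_parametrization M U \<phi> \<longrightarrow> (\<forall>b. smooth_on U (pullback \<phi> \<alpha> b)))"

definition smooth_vector_field ::
    "'d::finite itself \<Rightarrow> 'a::euclidean_space set \<Rightarrow> ('a \<Rightarrow> 'a \<times> 'a) \<Rightarrow> bool" where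
  "smooth_vector_field d M T \<longleftrightarrow>
     (\<forall>p\<in>M. T p \<in> CT d M p) \<and>
     (\<forall>U (\<phi> :: real^'d \<Rightarrow> 'a). local_parametrization M U \<phi> \<longrightarrow> smooth_on U (T \<circ> \<phi>))"

definition chart_at ::
    "'d::finite itself \<Rightarrow> 'a::euclidean_space set \<Rightarrow> 'a \<Rightarrow> (real^'d \<Rightarrow> 'a) \<times> (real^'d)" where
  "chart_at d M p = (SOME (\<phi>, u). \<exists>U. local_parametrization M U \<phi> \<and> u \<in> U \<and> \<phi> u = p)"

text \<open>The exterior derivative, computed in local coordinates and extended complex-bilinearly; for
  differentiable \<open>\<alpha>\<close> the result does not depend on the coordinates. The normalization is
  \<open>d\<alpha>(V \<and> W) = V(\<alpha>(W)) - W(\<alpha>(V)) - \<alpha>([V, W])\<close>.\<close>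

definition ext_deriv_real ::
    "'d::finite itself \<Rightarrow> 'a::euclidean_space set \<Rightarrow> 'a form1 \<Rightarrow> 'a \<Rightarrow> 'a \<Rightarrow> 'a \<Rightarrow> complex" where
  "ext_deriv_real d M \<alpha> p v w =
     (let (\<phi>, u) = chart_at d M p; a = inv (D \<phi> u) v; b = inv (D \<phi> u) w
      in D (pullback \<phi> \<alpha> b) u a - D (pullback \<phi> \<alpha> a) u b)"

definition ext_deriv :: "'d::finite itself \<Rightarrow> 'a::euclidean_space set \<Rightarrow> 'a form1 \<Rightarrow> 'a form2" where
  "ext_deriv d M \<alpha> p V W =
     ext_deriv_real d M \<alpha> p (fst V) (fst W) - ext_deriv_real d M \<alpha> p (snd V) (snd W) +
     \<i> * (ext_deriv_real d M \<alpha> p (fst V) (snd W) + ext_deriv_real d M \<alpha> p (snd V) (fst W))"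


section \<open>Tangential Cauchy--Riemann operators\<close>

definition orthonormal_frame ::
    "'d::finite itself \<Rightarrow> (complex^'N) set \<Rightarrow> complex^'N \<Rightarrow> ((complex^'N) \<times> (complex^'N)) set \<Rightarrow> bool" where
  "orthonormal_frame d M p B \<longleftrightarrow>
     finite B \<and> B \<subseteq> T10 d M p \<and> cvec.span B = T10 d M p \<and>
     (\<forall>L\<in>B. \<forall>L'\<in>B. hinner L L' = (if L = L' then 1 else 0))"

definition CR_orth_complement ::
    "'d::finite itself \<Rightarrow> (complex^'N) set \<Rightarrow> complex^'N \<Rightarrow> ((complex^'N) \<times> (complex^'N)) set" where
  "CR_orth_complement d M p =
     {V \<in> CT d M p. \<forall>W \<in> T10 d M p \<union> T01 d M p. hinner V W = 0}"

definition dual_frame ::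
    "'d::finite itself \<Rightarrow> (complex^'N) set \<Rightarrow> complex^'N \<Rightarrow> ((complex^'N) \<times> (complex^'N)) set \<Rightarrow>
     ((complex^'N) \<times> (complex^'N) \<Rightarrow> (complex^'N) \<times> (complex^'N) \<Rightarrow> complex) \<Rightarrow> bool" where
  "dual_frame d M p B \<omega> \<longleftrightarrow>
     (\<forall>L\<in>B. clinear_on (CT d M p) (\<omega> L) \<and>
            (\<forall>L'\<in>B. \<omega> L L' = (if L = L' then 1 else 0)) \<and>
            (\<forall>V \<in> T01 d M p \<union> CR_orth_complement d M p. \<omega> L V = 0))"

text \<open>The operators below do not depend on the choice of the frame, so a frame of the fibre at each
  point suffices.\<close>

definition CR_frame ::
    "'d::finite itself \<Rightarrow> (complex^'N) set \<Rightarrow> complex^'N \<Rightarrow> ((complex^'N) \<times> (complex^'N)) set \<times>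
     ((complex^'N) \<times> (complex^'N) \<Rightarrow> (complex^'N) \<times> (complex^'N) \<Rightarrow> complex)" where
  "CR_frame d M p = (SOME (B, \<omega>). orthonormal_frame d M p B \<and> dual_frame d M p B \<omega>)"

definition del_b :: "'d::finite itself \<Rightarrow> (complex^'N) set \<Rightarrow> (complex^'N \<Rightarrow> complex) \<Rightarrow> (complex^'N) form1" where
  "del_b d M f p V =
     (let (B, \<omega>) = CR_frame d M p in \<Sum>L\<in>B. vderiv L f p * \<omega> L V)"

text \<open>The conjugate of a form \<open>\<omega>\<close> takes the value \<open>cnj (\<omega> (cconj V))\<close> at \<open>V\<close>.\<close>

definition dbar_b :: "'d::finite itself \<Rightarrow> (complex^'N) set \<Rightarrow> (complex^'N \<Rightarrow> complex) \<Rightarrow> (complex^'N) form1" where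
  "dbar_b d M f p V =
     (let (B, \<omega>) = CR_frame d M p in \<Sum>L\<in>B. vderiv (cconj L) f p * cnj (\<omega> L (cconj V)))"

text \<open>The component \<open>\<Sum>\<^sub>i\<^sub>j \<beta>(L\<^sub>i \<and> cconj L\<^sub>j) \<omega>\<^sub>i \<and> cnj \<omega>\<^sub>j\<close> of type (1,1) of a 2-form \<open>\<beta>\<close>.\<close>

definition component11 :: "'d::finite itself \<Rightarrow> (complex^'N) set \<Rightarrow> (complex^'N) form2 \<Rightarrow> (complex^'N) form2" where
  "component11 d M \<beta> p V W =
     (let (B, \<omega>) = CR_frame d M p in
      \<Sum>L\<in>B. \<Sum>L'\<in>B. \<beta> p L (cconj L') *
        (\<omega> L V * cnj (\<omega> L' (cconj W)) - \<omega> L W * cnj (\<omega> L' (cconj V))))"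

text \<open>\<open>del_b1\<close> is for forms of type (0,1) only, \<open>dbar_b1\<close> for forms of type (1,0) only; in both
  cases the result is the (1,1) component of the exterior derivative.\<close>

definition del_b1 :: "'d::finite itself \<Rightarrow> (complex^'N) set \<Rightarrow> (complex^'N) form1 \<Rightarrow> (complex^'N) form2" where
  "del_b1 d M \<alpha> = component11 d M (ext_deriv d M \<alpha>)"

definition dbar_b1 :: "'d::finite itself \<Rightarrow> (complex^'N) set \<Rightarrow> (complex^'N) form1 \<Rightarrow> (complex^'N) form2" where
  "dbar_b1 d M \<alpha> = component11 d M (ext_deriv d M \<alpha>)"


section \<open>Pseudoconvexity and plurisubharmonicity\<close>

text \<open>Used only for \<open>H\<close> that are sesquilinear by construction (linear in the first argument).\<close>

definition hermitian_form_on :: "'v set \<Rightarrow> ('v \<Rightarrow> 'v \<Rightarrow> complex) \<Rightarrow> bool" where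
  "hermitian_form_on S H \<longleftrightarrow> (\<forall>L\<in>S. \<forall>L'\<in>S. H L' L = cnj (H L L'))"

definition positive_semidefinite_on :: "'v set \<Rightarrow> ('v \<Rightarrow> 'v \<Rightarrow> complex) \<Rightarrow> bool" where
  "positive_semidefinite_on S H \<longleftrightarrow> hermitian_form_on S H \<and> (\<forall>L\<in>S. 0 \<le> Re (H L L))"

definition positive_definite_on :: "'v::zero set \<Rightarrow> ('v \<Rightarrow> 'v \<Rightarrow> complex) \<Rightarrow> bool" where
  "positive_definite_on S H \<longleftrightarrow> hermitian_form_on S H \<and> (\<forall>L\<in>S. L \<noteq> 0 \<longrightarrow> 0 < Re (H L L))"

definition levi_form ::
    "'d::finite itself \<Rightarrow> (complex^'N) set \<Rightarrow> (complex^'N) form1 \<Rightarrow> complex^'N \<Rightarrow>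
     (complex^'N) \<times> (complex^'N) \<Rightarrow> (complex^'N) \<times> (complex^'N) \<Rightarrow> complex" where
  "levi_form d M \<gamma> p L L' = ext_deriv d M \<gamma> p L (cconj L')"

definition characteristic_form ::
    "'d::finite itself \<Rightarrow> (complex^'N) set \<Rightarrow> (complex^'N) form1 \<Rightarrow>
     (complex^'N \<Rightarrow> (complex^'N) \<times> (complex^'N)) \<Rightarrow> bool" where
  "characteristic_form d M \<gamma> T \<longleftrightarrow>
     smooth_form1 d M \<gamma> \<and> smooth_vector_field d M T \<and>
     (\<forall>p\<in>M.
        (\<forall>V \<in> CT d M p. cnj (\<gamma> p (cconj V)) = - \<gamma> p V) \<and>
        (\<forall>V \<in> T10 d M p \<union> T01 d M p. \<gamma> p V = 0) \<and>
        cconj (T p) = - T p \<and>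
        cvec.span (insert (T p) (T10 d M p \<union> T01 d M p)) = CT d M p \<and>
        \<gamma> p (T p) = -1)"

definition pseudoconvex_form ::
    "'d::finite itself \<Rightarrow> (complex^'N) set \<Rightarrow> (complex^'N) form1 \<Rightarrow> bool" where
  "pseudoconvex_form d M \<gamma> \<longleftrightarrow>
     (\<exists>T. characteristic_form d M \<gamma> T) \<and>
     (\<forall>p\<in>M. positive_semidefinite_on (T10 d M p) (levi_form d M \<gamma> p))"

text \<open>\<open>M\<close> is weakly pseudoconvex if it carries a form \<open>\<gamma>\<close> with \<open>pseudoconvex_form d M \<gamma>\<close>. Strong
  CR plurisubharmonicity refers to such a form, hence the argument \<open>\<gamma>\<close>.\<close>

definition strongly_CR_psh ::
    "'d::finite itself \<Rightarrow> (complex^'N) set \<Rightarrow> (complex^'N) form1 \<Rightarrow> (complex^'N \<Rightarrow> real) \<Rightarrow> bool" where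
  "strongly_CR_psh d M \<gamma> h \<longleftrightarrow>
     (\<exists>U. open U \<and> M \<subseteq> U \<and> smooth_on U h) \<and>
     (\<exists>A\<^sub>0::real. A\<^sub>0 > 0 \<and> (\<forall>p\<in>M.
        positive_definite_on (T10 d M p) (\<lambda>L L'.
          (del_b1 d M (dbar_b d M (complex_of_real \<circ> h)) p L (cconj L') -
           dbar_b1 d M (del_b d M (complex_of_real \<circ> h)) p L (cconj L')) / 2 +
          complex_of_real A\<^sub>0 * ext_deriv d M \<gamma> p L (cconj L'))))"

text \<open>Wirtinger derivatives and the complex Hessian on complex Euclidean space.\<close>

definition del_z :: "'N::finite \<Rightarrow> (complex^'N \<Rightarrow> complex) \<Rightarrow> complex^'N \<Rightarrow> complex" where
  "del_z j f z = (D f z (axis j 1) - \<i> * D f z (axis j \<i>)) / 2"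

definition del_zbar :: "'N::finite \<Rightarrow> (complex^'N \<Rightarrow> complex) \<Rightarrow> complex^'N \<Rightarrow> complex" where
  "del_zbar j f z = (D f z (axis j 1) + \<i> * D f z (axis j \<i>)) / 2"

definition strongly_psh :: "(complex^'N \<Rightarrow> real) \<Rightarrow> bool" where
  "strongly_psh h \<longleftrightarrow>
     (\<forall>z. positive_definite_on UNIV (\<lambda>\<xi> \<eta> :: complex^'N.
        \<Sum>j\<in>UNIV. \<Sum>k\<in>UNIV. del_z j (del_zbar k (complex_of_real \<circ> h)) z * \<xi> $ j * cnj (\<eta> $ k)))"

end

theory Submission
  imports Defs
begin

text \<open>Let \<open>G\<close> be the real tangent field with \<open>\<gamma>(v) = \<i> (v \<bullet> G)\<close>, and \<open>J\<close> the complex structure. As \<open>G\<close>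
  spans the orthogonal complement of \<open>T10 \<oplus> T01\<close>, the form \<open>(dbar_b h - del_b h) / 2\<close> on \<open>M\<close> equals
  \<open>(\<i>/2) (dh \<circ> J) - (\<kappa>/2) \<gamma>\<close> with \<open>\<kappa> = dh(J G) / \<bar>G\<bar>\<^sup>2\<close>. Since \<open>\<gamma>\<close> vanishes on \<open>T10 \<oplus> T01\<close>, no
  derivative of \<open>\<kappa>\<close> survives in the exterior derivative at \<open>L \<and> cconj L'\<close>: it is the ambient complex
  Hessian of \<open>h\<close> minus \<open>\<kappa>/2\<close> times the Levi form. From \<open>\<gamma>(T) = -1\<close> one gets \<open>\<bar>\<kappa>\<bar> \<le> \<bar>dh\<bar> \<bar>T\<bar>\<close>, which is
  bounded on the compact \<open>M\<close>, so a large multiple of the positive semidefinite Levi form absorbs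
  this term.\<close>

section \<open>Second derivatives\<close>

text \<open>The frame behind \<open>CR_frame\<close> is chosen separately at each point, so nothing
  written in terms of it can be differentiated directly. The forms must first be expressed without a
  frame, on a whole chart domain and on all real tangent vectors, also those transverse to
  \<open>T10\<close> and \<open>T01\<close>, because \<open>ext_deriv_real\<close> differentiates
  coefficients in a chart. This is why the field \<open>G\<close> enters: orthogonal projection
  along \<open>G\<close> splits a real vector into a (1,0) part, its conjugate and a multiple of
  \<open>G\<close>, and \<open>del_b\<close> is known on each of the three. The coefficient \<kappa>
  is the price of this projection. In the difference of \<open>dbar_b\<close> and
  \<open>del_b\<close> the part without \<open>J\<close> cancels, so only one real family of
  coefficients has to be differentiated explicitly.\<close>

lemma smooth_on_differentiable: "smooth_on U f \<Longrightarrow> x \<in> U \<Longrightarrow> f differentiable (at x)"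
  unfolding smooth_on_def by (metis Ck_on.simps(2))

lemma smooth_on_D: "smooth_on U f \<Longrightarrow> smooth_on U (\<lambda>x. D f x v)"
  unfolding smooth_on_def by (metis Ck_on.simps(2))

lemma smooth_on_continuous: "smooth_on U f \<Longrightarrow> continuous_on U f"
  unfolding smooth_on_def by (metis Ck_on.simps(1))

lemma smooth_on_has_derivative:
  "smooth_on U f \<Longrightarrow> x \<in> U \<Longrightarrow> (f has_derivative D f x) (at x)"
  using smooth_on_differentiable frechet_derivative_works by blast

lemma D_eqI: "(f has_derivative f') (at x) \<Longrightarrow> D f x = f'"
  by (rule frechet_derivative_at[symmetric])

lemma smooth_on_linear_D: "smooth_on U f \<Longrightarrow> x \<in> U \<Longrightarrow> linear (D f x)"
  using smooth_on_has_derivative has_derivative_linear by blast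

section \<open>Symmetry of second derivatives of real-valued maps\<close>

lemma has_field_derivative_along_line:
  fixes f :: "'a::real_normed_vector \<Rightarrow> real"
  assumes "(f has_derivative f') (at (x + s *\<^sub>R v))"
  shows "((\<lambda>\<sigma>. f (x + \<sigma> *\<^sub>R v)) has_field_derivative f' v) (at s)"
proof -
  have "((\<lambda>\<sigma>. f (x + \<sigma> *\<^sub>R v)) has_derivative (\<lambda>\<sigma>. f' (\<sigma> *\<^sub>R v))) (at s)"
    by (rule has_derivative_compose[of "\<lambda>\<sigma>. x + \<sigma> *\<^sub>R v", OF _ assms])
       (auto intro!: derivative_eq_intros)
  moreover have "(\<lambda>\<sigma>. f' (\<sigma> *\<^sub>R v)) = (*) (f' v)"
    using linear_scale[OF has_derivative_linear[OF assms]] by (auto simp: fun_eq_iff)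
  ultimately show ?thesis by (simp add: has_field_derivative_def)
qed

text \<open>The left side is symmetric in \<open>v\<close> and \<open>w\<close>, which lets the two
  mixed derivatives be compared. The mean value theorem is applied in direction \<open>v\<close> to
  a difference of two translates of \<open>f\<close>, then in direction \<open>w\<close> to the
  derivative so obtained.\<close>

lemma second_difference_mean_value:
  fixes f :: "'a::real_normed_vector \<Rightarrow> real"
  assumes f: "smooth_on U f" and t: "t > 0"
    and U: "\<And>\<sigma> \<tau>. \<lbrakk>0 \<le> \<sigma>; \<sigma> \<le> t; 0 \<le> \<tau>; \<tau> \<le> t\<rbrakk> \<Longrightarrow> x + \<sigma> *\<^sub>R v + \<tau> *\<^sub>R w \<in> U"
  obtains \<sigma> \<tau> where "0 < \<sigma>" "\<sigma> < t" "0 < \<tau>" "\<tau> < t"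
    "f (x + t *\<^sub>R v + t *\<^sub>R w) - f (x + t *\<^sub>R v) - f (x + t *\<^sub>R w) + f x =
       t * t * D (\<lambda>y. D f y v) (x + \<sigma> *\<^sub>R v + \<tau> *\<^sub>R w) w"
proof -
  define g where "g \<sigma> = f (x + t *\<^sub>R w + \<sigma> *\<^sub>R v) - f (x + \<sigma> *\<^sub>R v)" for \<sigma>
  have "(g has_field_derivative D f (x + t *\<^sub>R w + s *\<^sub>R v) v - D f (x + s *\<^sub>R v) v) (at s)"
    if "0 \<le> s" "s \<le> t" for s
    unfolding g_def using U[of s t] U[of s 0] that t
    by (intro DERIV_diff has_field_derivative_along_line smooth_on_has_derivative[OF f])
       (auto simp: algebra_simps)
  from MVT2[OF t this] obtain \<sigma> where \<sigma>: "0 < \<sigma>" "\<sigma> < t"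
    "g t - g 0 = t * (D f (x + t *\<^sub>R w + \<sigma> *\<^sub>R v) v - D f (x + \<sigma> *\<^sub>R v) v)" by auto
  have "((\<lambda>\<tau>. D f (x + \<sigma> *\<^sub>R v + \<tau> *\<^sub>R w) v) has_field_derivative
      D (\<lambda>y. D f y v) (x + \<sigma> *\<^sub>R v + s *\<^sub>R w) w) (at s)"
    if "0 \<le> s" "s \<le> t" for s
    using U[of \<sigma> s] that \<sigma>
    by (intro has_field_derivative_along_line smooth_on_has_derivative[OF smooth_on_D[OF f]]) auto
  from MVT2[OF t this] obtain \<tau> where \<tau>: "0 < \<tau>" "\<tau> < t"
    "D f (x + \<sigma> *\<^sub>R v + t *\<^sub>R w) v - D f (x + \<sigma> *\<^sub>R v) v =
       t * D (\<lambda>y. D f y v) (x + \<sigma> *\<^sub>R v + \<tau> *\<^sub>R w) w" by auto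
  have "f (x + t *\<^sub>R v + t *\<^sub>R w) - f (x + t *\<^sub>R v) - f (x + t *\<^sub>R w) + f x = g t - g 0"
    by (simp add: g_def algebra_simps)
  also have "\<dots> = t * t * D (\<lambda>y. D f y v) (x + \<sigma> *\<^sub>R v + \<tau> *\<^sub>R w) w"
    using \<sigma>(3) \<tau>(3) by (simp add: algebra_simps)
  finally show thesis by (rule that[OF \<sigma>(1,2) \<tau>(1,2)])
qed

text \<open>The same second difference, taken in both orders, is \<open>t * t\<close> times either
  mixed derivative at some nearby point. Both mixed derivatives are continuous, so a gap between
  them at \<open>x\<close> is impossible.\<close>

lemma D2_symmetric_real:
  fixes f :: "'a::real_normed_vector \<Rightarrow> real"
  assumes f: "smooth_on U f" and U: "open U" "x \<in> U"
  shows "D (\<lambda>y. D f y v) x w = D (\<lambda>y. D f y w) x v"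
proof (rule ccontr)
  let ?A = "\<lambda>y. D (\<lambda>y. D f y v) y w" and ?B = "\<lambda>y. D (\<lambda>y. D f y w) y v"
  assume "?A x \<noteq> ?B x"
  define e where "e = \<bar>?A x - ?B x\<bar> / 2"
  have "e > 0" using \<open>?A x \<noteq> ?B x\<close> by (simp add: e_def)
  have "isCont ?A x" "isCont ?B x"
    using smooth_on_continuous[OF smooth_on_D[OF smooth_on_D[OF f]]] continuous_on_eq_continuous_at[OF U(1)] U(2)
    by blast+
  then have lim: "(?A \<longlongrightarrow> ?A x) (nhds x)" "(?B \<longlongrightarrow> ?B x) (nhds x)"
    unfolding isCont_def tendsto_at_iff_tendsto_nhds[of ?A x] tendsto_at_iff_tendsto_nhds[of ?B x] .
  have "\<forall>\<^sub>F y in nhds x. y \<in> U \<and> dist (?A y) (?A x) < e \<and> dist (?B y) (?B x) < e"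
    by (intro eventually_conj tendstoD[OF lim(1) \<open>e > 0\<close>] tendstoD[OF lim(2) \<open>e > 0\<close>]
        eventually_nhds_in_open U)
  then obtain d where d: "d > 0"
    "\<And>y. dist y x < d \<Longrightarrow> y \<in> U \<and> dist (?A y) (?A x) < e \<and> dist (?B y) (?B x) < e"
    unfolding eventually_nhds_metric by blast
  \<comment> \<open>Small enough that the parallelogram with sides \<open>t *\<^sub>R v\<close> and
    \<open>t *\<^sub>R w\<close> stays in the ball of radius \<open>d\<close>; the summand 1 covers
    \<open>v = w = 0\<close>.\<close>
  define t where "t = d / (2 * (norm v + norm w + 1))"
  have t: "t > 0" using d(1) unfolding t_def by (smt (verit) divide_pos_pos norm_ge_zero)
  have "t * (norm v + norm w) < t * (norm v + norm w + 1)" using t by simp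
  also have "\<dots> = d / 2"
  proof -
    have "norm v + norm w + 1 \<noteq> 0" by (smt (verit) norm_ge_zero)
    then show ?thesis unfolding t_def by (simp add: field_simps)
  qed
  finally have td: "t * (norm v + norm w) < d" using d(1) by simp
  have near: "dist (x + \<sigma> *\<^sub>R v + \<tau> *\<^sub>R w) x < d"
    if "0 \<le> \<sigma>" "\<sigma> \<le> t" "0 \<le> \<tau>" "\<tau> \<le> t" for \<sigma> \<tau>
  proof -
    have "dist (x + \<sigma> *\<^sub>R v + \<tau> *\<^sub>R w) x = norm (\<sigma> *\<^sub>R v + \<tau> *\<^sub>R w)" by (simp add: dist_norm)
    also have "\<dots> \<le> \<sigma> * norm v + \<tau> * norm w"
      using norm_triangle_ineq[of "\<sigma> *\<^sub>R v" "\<tau> *\<^sub>R w"] that by simp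
    also have "\<dots> \<le> t * norm v + t * norm w" using that by (intro add_mono mult_right_mono) auto
    finally show ?thesis using td by (simp add: algebra_simps)
  qed
  have near': "dist (x + \<sigma> *\<^sub>R w + \<tau> *\<^sub>R v) x < d"
    if "0 \<le> \<sigma>" "\<sigma> \<le> t" "0 \<le> \<tau>" "\<tau> \<le> t" for \<sigma> \<tau>
    using near[OF that(3,4,1,2)] by (simp add: algebra_simps)
  obtain \<sigma> \<tau> where 1: "0 < \<sigma>" "\<sigma> < t" "0 < \<tau>" "\<tau> < t"
    "f (x + t *\<^sub>R v + t *\<^sub>R w) - f (x + t *\<^sub>R v) - f (x + t *\<^sub>R w) + f x = t * t * ?A (x + \<sigma> *\<^sub>R v + \<tau> *\<^sub>R w)"
    by (rule second_difference_mean_value[OF f t, of x v w, OF conjunct1[OF d(2)[OF near]]])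
  obtain \<sigma>' \<tau>' where 2: "0 < \<sigma>'" "\<sigma>' < t" "0 < \<tau>'" "\<tau>' < t"
    "f (x + t *\<^sub>R w + t *\<^sub>R v) - f (x + t *\<^sub>R w) - f (x + t *\<^sub>R v) + f x = t * t * ?B (x + \<sigma>' *\<^sub>R w + \<tau>' *\<^sub>R v)"
    by (rule second_difference_mean_value[OF f t, of x w v, OF conjunct1[OF d(2)[OF near']]])
  have "t * t * ?A (x + \<sigma> *\<^sub>R v + \<tau> *\<^sub>R w) = t * t * ?B (x + \<sigma>' *\<^sub>R w + \<tau>' *\<^sub>R v)"
    using 1(5) 2(5) by (simp add: algebra_simps)
  then have eq: "?A (x + \<sigma> *\<^sub>R v + \<tau> *\<^sub>R w) = ?B (x + \<sigma>' *\<^sub>R w + \<tau>' *\<^sub>R v)"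
    using t by simp
  have "dist (?A x) (?A (x + \<sigma> *\<^sub>R v + \<tau> *\<^sub>R w)) < e"
    using d(2)[OF near] 1 by (simp add: less_imp_le dist_commute)
  moreover have "dist (?B x) (?B (x + \<sigma>' *\<^sub>R w + \<tau>' *\<^sub>R v)) < e"
    using d(2)[OF near'] 2 by (simp add: less_imp_le dist_commute)
  ultimately have "dist (?A x) (?B x) < e + e"
    unfolding eq by (rule dist_triangle_less_add)
  then show False by (simp only: e_def dist_real_def field_sum_of_halves less_irrefl)
qed

section \<open>Passage to vector-valued maps through inner products\<close>

lemma has_derivative_inner_const:
  "(f has_derivative f') F \<Longrightarrow> ((\<lambda>x. f x \<bullet> e) has_derivative (\<lambda>v. f' v \<bullet> e)) F"
  by (auto intro!: derivative_eq_intros)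

text \<open>On an open set each derivative depends only on the values in that set, so the agreement
  passes to all iterated derivatives by induction.\<close>

lemma Ck_on_cong:
  assumes "open U" "\<And>x. x \<in> U \<Longrightarrow> f x = g x" "Ck_on k U f"
  shows "Ck_on k U g"
  using assms(2,3)
proof (induction k arbitrary: f g)
  case 0 then show ?case by (auto intro: continuous_on_eq)
next
  case (Suc k)
  have f: "(f has_derivative D f x) (at x)" if "x \<in> U" for x
    using Suc.prems(2) that frechet_derivative_works by (metis Ck_on.simps(2))
  have g: "(g has_derivative D f x) (at x)" if "x \<in> U" for x
    by (rule has_derivative_transform_within_open[OF f[OF that] assms(1) that Suc.prems(1)])
  have "Ck_on k U (\<lambda>x. D g x v)" for v
  proof (rule Suc.IH)
    show "D f x v = D g x v" if "x \<in> U" for x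
      unfolding D_eqI[OF g[OF that]] ..
    show "Ck_on k U (\<lambda>x. D f x v)" using Suc.prems(2) by simp
  qed
  moreover have "g differentiable (at x)" if "x \<in> U" for x
    using g[OF that] unfolding differentiable_def by blast
  ultimately show ?case by simp
qed

lemma smooth_on_inner_const:
  assumes "open U" "smooth_on U f"
  shows "smooth_on U (\<lambda>x. f x \<bullet> e)"
proof -
  have "Ck_on k U f \<Longrightarrow> Ck_on k U (\<lambda>x. f x \<bullet> e)" for k f
  proof (induction k arbitrary: f)
    case 0 then show ?case by (auto intro!: continuous_intros)
  next
      case (Suc k)
    have h: "((\<lambda>x. f x \<bullet> e) has_derivative (\<lambda>v. D f x v \<bullet> e)) (at x)" if "x \<in> U" for x
    proof (rule has_derivative_inner_const)
      have "f differentiable (at x)" using Suc.prems that by simp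
      then show "(f has_derivative D f x) (at x)" unfolding frechet_derivative_works .
    qed
    have "Ck_on k U (\<lambda>x. D (\<lambda>x. f x \<bullet> e) x v)" for v
    proof (rule Ck_on_cong[OF assms(1)])
      show "D f x v \<bullet> e = D (\<lambda>x. f x \<bullet> e) x v" if "x \<in> U" for x
        unfolding D_eqI[OF h[OF that]] ..
      show "Ck_on k U (\<lambda>x. D f x v \<bullet> e)"
        by (rule Suc.IH) (use Suc.prems in simp)
    qed
    moreover have "(\<lambda>x. f x \<bullet> e) differentiable (at x)" if "x \<in> U" for x
      using h[OF that] unfolding differentiable_def by blast
    ultimately show ?case by simp
  qed
  then show ?thesis using assms(2) unfolding smooth_on_def by blast
qed

text \<open>Pairing with a basis vector \<open>e\<close> commutes with both differentiations, which
  reduces the claim to real-valued maps.\<close>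

lemma D2_symmetric:
  fixes f :: "'a::real_normed_vector \<Rightarrow> 'b::euclidean_space"
  assumes f: "smooth_on U f" and U: "open U" "x \<in> U"
  shows "D (\<lambda>y. D f y v) x w = D (\<lambda>y. D f y w) x v"
proof (rule euclidean_eqI)
  fix e :: 'b
  let ?g = "\<lambda>x. f x \<bullet> e"
  have 1: "D ?g y u = D f y u \<bullet> e" if "y \<in> U" for y u
    by (simp add: D_eqI[OF has_derivative_inner_const[OF smooth_on_has_derivative[OF f that]]])
  have 2: "D (\<lambda>y. D ?g y u) x u' = D (\<lambda>y. D f y u) x u' \<bullet> e" for u u'
  proof -
    have h: "((\<lambda>y. D f y u \<bullet> e) has_derivative (\<lambda>u'. D (\<lambda>y. D f y u) x u' \<bullet> e)) (at x)"
      by (intro has_derivative_inner_const smooth_on_has_derivative[OF smooth_on_D[OF f] U(2)])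
    have "((\<lambda>y. D ?g y u) has_derivative (\<lambda>u'. D (\<lambda>y. D f y u) x u' \<bullet> e)) (at x)"
      by (rule has_derivative_transform_within_open[OF h U]) (simp add: 1)
    from D_eqI[OF this] show ?thesis by simp
  qed
  show "D (\<lambda>y. D f y v) x w \<bullet> e = D (\<lambda>y. D f y w) x v \<bullet> e"
    using D2_symmetric_real[OF smooth_on_inner_const[OF U(1) f, of e] U, of v w] by (simp add: 2)
qed

text \<open>Linearity in the direction of the inner derivative is inherited from
  \<open>D f y\<close> for all \<open>y\<close> near \<open>x\<close>; linearity in \<open>w\<close>
  is that of any derivative.\<close>

lemma D2_linear:
  assumes f: "smooth_on U f" and U: "open U" "x \<in> U"
  shows "linear (\<lambda>v. D (\<lambda>y. D f y v) x w)"
proof (rule linearI)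
  note h = smooth_on_has_derivative[OF smooth_on_D[OF f] U(2)]
  fix a b :: 'a and r :: real
  have "((\<lambda>y. D f y (a + b)) has_derivative (\<lambda>w. D (\<lambda>y. D f y a) x w + D (\<lambda>y. D f y b) x w)) (at x)"
    by (rule has_derivative_transform_within_open[OF has_derivative_add[OF h h] U])
       (simp add: linear_add[OF smooth_on_linear_D[OF f]])
  from D_eqI[OF this] show "D (\<lambda>y. D f y (a + b)) x w = D (\<lambda>y. D f y a) x w + D (\<lambda>y. D f y b) x w"
    by simp
  have "((\<lambda>y. D f y (r *\<^sub>R a)) has_derivative (\<lambda>w. r *\<^sub>R D (\<lambda>y. D f y a) x w)) (at x)"
    by (rule has_derivative_transform_within_open[OF has_derivative_scaleR_right[OF h] U])
       (simp add: linear_scale[OF smooth_on_linear_D[OF f]])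
  from D_eqI[OF this] show "D (\<lambda>y. D f y (r *\<^sub>R a)) x w = r *\<^sub>R D (\<lambda>y. D f y a) x w"
    by simp
qed

section \<open>Chain rule for a derivative with moving base point and moving direction\<close>

lemma linear_basis_expansion:
  fixes f :: "'a::euclidean_space \<Rightarrow> 'b::real_vector"
  assumes "linear f"
  shows "f v = (\<Sum>e\<in>Basis. (v \<bullet> e) *\<^sub>R f e)"
proof -
  have "f v = f (\<Sum>e\<in>Basis. (v \<bullet> e) *\<^sub>R e)" by (simp add: euclidean_representation)
  also have "\<dots> = (\<Sum>e\<in>Basis. (v \<bullet> e) *\<^sub>R f e)"
    using assms by (simp add: linear_sum linear_scale)
  finally show ?thesis .
qed

text \<open>Expanding the direction \<open>w\<close> in a basis avoids a derivative of the operator-valued map \<open>D f\<close>.\<close>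

lemma has_derivative_D_along:
  fixes f :: "'a::euclidean_space \<Rightarrow> 'b::real_normed_vector"
  assumes f: "smooth_on U f" and U: "open U" "\<phi> u \<in> U"
    and \<phi>: "(\<phi> has_derivative \<phi>') (at u)" and w: "(w has_derivative w') (at u)"
  shows "((\<lambda>x. D f (\<phi> x) (w x)) has_derivative
     (\<lambda>a. D f (\<phi> u) (w' a) + D (\<lambda>y. D f y (w u)) (\<phi> u) (\<phi>' a))) (at u)"
proof -
  note expand = linear_basis_expansion[OF smooth_on_linear_D[OF f]]
  note expand2 = linear_basis_expansion[OF D2_linear[OF f U]]
  have c: "((\<lambda>x. D f (\<phi> x) e) has_derivative (\<lambda>a. D (\<lambda>y. D f y e) (\<phi> u) (\<phi>' a))) (at u)" for e
    by (rule has_derivative_compose[OF \<phi> smooth_on_has_derivative[OF smooth_on_D[OF f] U(2)]])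
  have 1: "((\<lambda>x. \<Sum>e\<in>Basis. (w x \<bullet> e) *\<^sub>R D f (\<phi> x) e) has_derivative
     (\<lambda>a. \<Sum>e\<in>Basis. (w u \<bullet> e) *\<^sub>R D (\<lambda>y. D f y e) (\<phi> u) (\<phi>' a) + (w' a \<bullet> e) *\<^sub>R D f (\<phi> u) e)) (at u)"
    by (intro has_derivative_sum has_derivative_scaleR has_derivative_inner_const w c)
  have "isCont \<phi> u" using \<phi> has_derivative_continuous by blast
  then have "\<forall>\<^sub>F x in nhds u. \<phi> x \<in> U"
    using U unfolding isCont_def tendsto_at_iff_tendsto_nhds by (rule topological_tendstoD)
  then obtain V where V: "open V" "u \<in> V" "\<And>x. x \<in> V \<Longrightarrow> \<phi> x \<in> U" unfolding eventually_nhds by blast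
  have "((\<lambda>x. D f (\<phi> x) (w x)) has_derivative
     (\<lambda>a. \<Sum>e\<in>Basis. (w u \<bullet> e) *\<^sub>R D (\<lambda>y. D f y e) (\<phi> u) (\<phi>' a) + (w' a \<bullet> e) *\<^sub>R D f (\<phi> u) e)) (at u)"
    by (rule has_derivative_transform_within_open[OF 1 V(1,2)]) (simp only: expand[OF V(3), symmetric])
  moreover have "D f (\<phi> u) (w' a) + D (\<lambda>y. D f y (w u)) (\<phi> u) (\<phi>' a) =
      (\<Sum>e\<in>Basis. (w u \<bullet> e) *\<^sub>R D (\<lambda>y. D f y e) (\<phi> u) (\<phi>' a) + (w' a \<bullet> e) *\<^sub>R D f (\<phi> u) e)" for a
    unfolding sum.distrib expand[OF U(2), of "w' a", symmetric] expand2[of "w u" "\<phi>' a", symmetric]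
    by (rule add.commute)
  ultimately show ?thesis by (simp only:)
qed

section \<open>Hermitian linear algebra\<close>

lemma hinner_add_left: "hinner (V + W) X = hinner V X + hinner W X"
  by (simp add: hinner_def inner_add_left complex_eq_iff)

lemma hinner_cscale_left: "hinner (cscale c V) W = c * hinner V W"
  by (simp add: hinner_def cscale_def inner_simps complex_eq_iff algebra_simps)

lemma hinner_diff_left: "hinner (V - W) X = hinner V X - hinner W X"
  by (simp add: hinner_def inner_diff_left complex_eq_iff)

lemma hinner_commute: "hinner W V = cnj (hinner V W)"
  by (simp add: hinner_def complex_eq_iff inner_commute)

lemma hinner_self: "hinner V V = complex_of_real (V \<bullet> V)"
  by (simp add: hinner_def complex_eq_iff inner_prod_def inner_commute)

lemma cscale_of_real: "cscale (complex_of_real r) V = r *\<^sub>R V"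
  by (simp add: cscale_def prod_eq_iff)

lemma cvec_subspace_imp_subspace:
  assumes "cvec.subspace S" shows "subspace S"
  using assms cscale_of_real unfolding subspace_def cvec.subspace_def by metis

text \<open>Gram-Schmidt: split off a unit vector \<open>e\<close> and pass to its Hermitian
  complement in \<open>S\<close>. The induction runs on the real dimension, which drops since
  \<open>e\<close> is not in the complement.\<close>

lemma hermitian_orthonormal_basis_exists:
  fixes S :: "('a::euclidean_space \<times> 'a) set"
  assumes "cvec.subspace S"
  shows "\<exists>B. finite B \<and> B \<subseteq> S \<and> cvec.span B = S \<and>
    (\<forall>L\<in>B. \<forall>L'\<in>B. hinner L L' = (if L = L' then 1 else 0))"
  using assms
proof (induction "dim S" arbitrary: S rule: less_induct)
  case less
  show ?case
  proof (cases "S = {0}")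
    case True
    then show ?thesis by (intro exI[of _ "{}"]) simp
  next
    case False
    then obtain v where v: "v \<in> S" "v \<noteq> 0"
      using cvec.subspace_0[OF less.prems] by blast
    define e where "e = (1 / norm v) *\<^sub>R v"
    have e: "e \<in> S"
      unfolding e_def by (rule subspace_scale[OF cvec_subspace_imp_subspace[OF less.prems] v(1)])
    have ee: "hinner e e = 1"
      using v(2) by (simp add: hinner_self e_def dot_square_norm power2_eq_square)
    define S' where "S' = {w \<in> S. hinner w e = 0}"
    have S': "cvec.subspace S'"
      using less.prems unfolding cvec.subspace_def S'_def
      by (auto simp: hinner_add_left hinner_cscale_left) (simp add: hinner_def zero_complex.code)
    have "e \<notin> S'" using ee by (simp add: S'_def)
    then have "S' \<subset> S" using e by (auto simp: S'_def)
    then have "dim S' < dim S"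
      using cvec_subspace_imp_subspace[OF less.prems] cvec_subspace_imp_subspace[OF S']
      by (intro dim_psubset) (metis span_eq_iff)
    from less.hyps[OF this S'] obtain B where B: "finite B" "B \<subseteq> S'" "cvec.span B = S'"
      "\<forall>L\<in>B. \<forall>L'\<in>B. hinner L L' = (if L = L' then 1 else 0)" by blast
    have orth: "hinner L e = 0" "hinner e L = 0" if "L \<in> B" for L
      using that B(2) hinner_commute[of e L] by (auto simp: S'_def)
    have "cvec.span (insert e B) = S"
    proof
      show "cvec.span (insert e B) \<subseteq> S"
        using e B(2) \<open>S' \<subset> S\<close> by (intro cvec.span_minimal less.prems) auto
      show "S \<subseteq> cvec.span (insert e B)"
      proof
        fix w assume "w \<in> S"
        then have "w - cscale (hinner w e) e \<in> S'"
          using e less.prems ee unfolding S'_def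
          by (auto simp: hinner_diff_left hinner_cscale_left intro: cvec.subspace_diff cvec.subspace_scale)
        then have "w - cscale (hinner w e) e \<in> cvec.span B" using B(3) by simp
        then show "w \<in> cvec.span (insert e B)" unfolding cvec.span_insert by blast
      qed
    qed
    moreover have "\<forall>L\<in>insert e B. \<forall>L'\<in>insert e B. hinner L L' = (if L = L' then 1 else 0)"
      using B(4) ee orth \<open>e \<notin> S'\<close> B(2) by auto
    ultimately show ?thesis
      using B(1,2) e \<open>S' \<subset> S\<close> by (intro exI[of _ "insert e B"]) auto
  qed
qed

lemma clinear_on_add: "clinear_on S f \<Longrightarrow> V \<in> S \<Longrightarrow> W \<in> S \<Longrightarrow> f (V + W) = f V + f W"
  by (simp add: clinear_on_def)

lemma clinear_on_cscale: "clinear_on S f \<Longrightarrow> V \<in> S \<Longrightarrow> f (cscale c V) = c * f V"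
  by (simp add: clinear_on_def)

lemma clinear_on_sum:
  assumes f: "clinear_on S f" and S: "cvec.subspace S" and g: "\<And>a. a \<in> A \<Longrightarrow> g a \<in> S"
  shows "f (\<Sum>a\<in>A. cscale (c a) (g a)) = (\<Sum>a\<in>A. c a * f (g a))"
  using g
proof (induction A rule: infinite_finite_induct)
  case (insert a A)
  have "(\<Sum>a\<in>A. cscale (c a) (g a)) \<in> S"
    using insert.prems S by (intro cvec.subspace_sum cvec.subspace_scale) auto
  moreover have "cscale (c a) (g a) \<in> S"
    using insert.prems S by (intro cvec.subspace_scale) auto
  ultimately show ?case
    using insert by (simp add: clinear_on_add[OF f] clinear_on_cscale[OF f])
qed (use clinear_on_cscale[OF f, of 0 0] cvec.subspace_0[OF S] in \<open>auto\<close>)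

lemma clinear_on_vderiv: "linear (D f p) \<Longrightarrow> clinear_on S (\<lambda>V. vderiv V f p)"
proof -
  assume l: "linear (D f p)"
  show ?thesis
    unfolding clinear_on_def
    by (auto simp: vderiv_def cscale_def linear_add[OF l] linear_diff[OF l] linear_scale[OF l]
        complex_eq_iff algebra_simps)
qed

lemma cconj_cconj [simp]: "cconj (cconj V) = V"
  by (simp add: cconj_def)

lemma cconj_cscale: "cconj (cscale c V) = cscale (cnj c) (cconj V)"
  by (simp add: cconj_def cscale_def)

lemma cconj_add: "cconj (V + W) = cconj V + cconj W"
  by (simp add: cconj_def)

section \<open>The complex structure of complex Euclidean space\<close>

abbreviation J :: "complex^'N \<Rightarrow> complex^'N" where "J v \<equiv> \<i> *s v"

lemma J_J [simp]: "J (J v) = - v"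
  by (simp add: vec_eq_iff flip: mult.assoc)

lemma J_add: "J (v + w) = J v + J w"
  by (simp add: vec_eq_iff algebra_simps)

lemma J_scaleR: "J (r *\<^sub>R v) = r *\<^sub>R J v"
  by (simp add: vec_eq_iff)

lemma J_minus: "J (- v) = - J v"
  by (simp add: vec_eq_iff)

lemma J_diff: "J (v - w) = J v - J w"
  by (simp add: vec_eq_iff algebra_simps)

lemma linear_J: "linear J"
  by (rule linearI) (simp_all add: J_add J_scaleR)

lemma inner_J_J: "J v \<bullet> J w = v \<bullet> w"
  by (simp add: inner_vec_def inner_complex_def algebra_simps)

lemma norm_J: "norm (J v) = norm v"
  by (simp add: norm_eq_sqrt_inner inner_J_J)

lemma inner_J_right: "v \<bullet> J w = - (J v \<bullet> w)"
  by (simp add: inner_vec_def inner_complex_def sum_negf[symmetric])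

lemma T10_D:
  assumes "V \<in> T10 d M p"
  shows "fst V \<in> tangent_space d M p" "snd V = - J (fst V)" "snd V \<in> tangent_space d M p"
  using assms by (auto simp: T10_def CT_def T10_ambient_def)

text \<open>The two vectors have the forms X + \<i>JX and Y - \<i>JY, and \<open>J\<close> is a skew
  isometry, so the terms cancel in pairs.\<close>

lemma hinner_T01_T10: "V \<in> T01 d M p \<Longrightarrow> W \<in> T10 d M p \<Longrightarrow> hinner V W = 0"
  by (auto simp: T01_def T10_def T10_ambient_def hinner_def cconj_def inner_J_J inner_J_right complex_eq_iff)

lemma subspace_CT:
  assumes "subspace (tangent_space d M p)"
  shows "cvec.subspace (CT d M p)"
  unfolding cvec.subspace_def CT_def
  using subspace_0[OF assms] subspace_add[OF assms] subspace_diff[OF assms] subspace_scale[OF assms]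
  by (simp add: cscale_def mem_Times_iff)

lemma subspace_T10:
  assumes "subspace (tangent_space d M p)"
  shows "cvec.subspace (T10 d M p)"
proof -
  have "cvec.subspace T10_ambient"
    unfolding cvec.subspace_def T10_ambient_def
    by (auto simp: cscale_def vec_eq_iff algebra_simps)
  then show ?thesis unfolding T10_def using subspace_CT[OF assms] by (intro cvec.subspace_inter)
qed

lemma cconj_CT: "subspace (tangent_space d M p) \<Longrightarrow> V \<in> CT d M p \<Longrightarrow> cconj V \<in> CT d M p"
  by (auto simp: CT_def cconj_def subspace_neg)

section \<open>Tangential Cauchy--Riemann operators\<close>

text \<open>Hermitian products with an orthonormal basis form a dual frame: they annihilate
  \<open>T01\<close> by \<open>hinner_T01_T10\<close> and the complement by its definition. Hence
  the choice in \<open>CR_frame\<close> is never vacuous here. Nothing is claimed about how frames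
  at different points fit together.\<close>

lemma CR_frame_correct:
  assumes "subspace (tangent_space d M p)" "CR_frame d M p = (B, \<omega>)"
  shows "orthonormal_frame d M p B" "dual_frame d M p B \<omega>"
proof -
  obtain B' where B': "orthonormal_frame d M p B'"
    using hermitian_orthonormal_basis_exists[OF subspace_T10[OF assms(1)]]
    unfolding orthonormal_frame_def by blast
  have "dual_frame d M p B' (\<lambda>L V. hinner V L)"
    using B' unfolding dual_frame_def orthonormal_frame_def clinear_on_def CR_orth_complement_def
    by (auto simp: hinner_add_left hinner_cscale_left intro: hinner_T01_T10)
  then have "\<exists>x. case x of (B, \<omega>) \<Rightarrow> orthonormal_frame d M p B \<and> dual_frame d M p B \<omega>"
    using B' by auto
  from someI_ex[OF this] assms(2)
  show "orthonormal_frame d M p B" "dual_frame d M p B \<omega>"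
    unfolding CR_frame_def by auto
qed

text \<open>Linearity and duality on \<open>B\<close> force \<omega> to read off the coefficients of
  any vector in the span of \<open>B\<close>.\<close>

lemma dual_frame_expansion:
  assumes S: "subspace (tangent_space d M p)"
    and B: "orthonormal_frame d M p B" and \<omega>: "dual_frame d M p B \<omega>"
    and V: "V \<in> T10 d M p"
  shows "V = (\<Sum>L\<in>B. cscale (\<omega> L V) L)"
proof -
  have fin: "finite B" and BT: "B \<subseteq> T10 d M p" using B unfolding orthonormal_frame_def by auto
  have "V \<in> cvec.span B" using B V by (simp add: orthonormal_frame_def)
  then obtain c where c: "V = (\<Sum>L\<in>B. cscale (c L) L)"
    unfolding cvec.span_finite[OF fin] by blast
  have "\<omega> L V = c L" if "L \<in> B" for L
  proof -
    have "\<omega> L V = (\<Sum>L'\<in>B. c L' * \<omega> L L')"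
      unfolding c using \<omega> that BT
      by (intro clinear_on_sum[where S = "CT d M p"] subspace_CT[OF S]) (auto simp: dual_frame_def T10_def)
    also have "\<dots> = (\<Sum>L'\<in>B. if L = L' then c L' else 0)"
      using \<omega> that by (intro sum.cong) (auto simp: dual_frame_def)
    finally show ?thesis using that fin by simp
  qed
  then show ?thesis by (subst c) (simp cong: sum.cong)
qed

text \<open>Together with \<open>del_b_eq_0\<close> and \<open>clinear_on_del_b\<close> this
  determines \<open>del_b\<close> without reference to the frame, so its coefficients can later be
  differentiated.\<close>

lemma del_b_T10:
  assumes S: "subspace (tangent_space d M p)" and f: "linear (D f p)" and V: "V \<in> T10 d M p"
  shows "del_b d M f p V = vderiv V f p"
proof -
  obtain B \<omega> where F: "CR_frame d M p = (B, \<omega>)" by fastforce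
  note fr = CR_frame_correct[OF S F]
  have "del_b d M f p V = (\<Sum>L\<in>B. \<omega> L V * vderiv L f p)"
    by (simp add: del_b_def F mult.commute)
  also have "\<dots> = vderiv (\<Sum>L\<in>B. cscale (\<omega> L V) L) f p"
    by (rule clinear_on_sum[OF clinear_on_vderiv[OF f, of UNIV], symmetric]) auto
  also have "\<dots> = vderiv V f p" using dual_frame_expansion[OF S fr V] by simp
  finally show ?thesis .
qed

lemma del_b_eq_0:
  assumes S: "subspace (tangent_space d M p)" and V: "V \<in> T01 d M p \<union> CR_orth_complement d M p"
  shows "del_b d M f p V = 0"
proof -
  obtain B \<omega> where F: "CR_frame d M p = (B, \<omega>)" by fastforce
  show ?thesis
    using CR_frame_correct(2)[OF S F] V
    by (auto simp: del_b_def F dual_frame_def intro!: sum.neutral)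
qed

lemma clinear_on_del_b:
  assumes S: "subspace (tangent_space d M p)"
  shows "clinear_on (CT d M p) (del_b d M f p)"
proof -
  obtain B \<omega> where F: "CR_frame d M p = (B, \<omega>)" by fastforce
  have "clinear_on (CT d M p) (\<omega> L)" if "L \<in> B" for L
    using CR_frame_correct(2)[OF S F] that by (simp add: dual_frame_def)
  then show ?thesis
    unfolding clinear_on_def del_b_def F
    by (auto simp: sum_distrib_left sum.distrib[symmetric] algebra_simps intro!: sum.cong)
qed

lemma dbar_b_eq_cnj:
  assumes h: "\<And>v. D (complex_of_real \<circ> h) p v = complex_of_real (D h p v)" and "linear (D h p)"
  shows "dbar_b d M (complex_of_real \<circ> h) p V = cnj (del_b d M (complex_of_real \<circ> h) p (cconj V))"
proof -
  obtain B \<omega> where F: "CR_frame d M p = (B, \<omega>)" by fastforce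
  have "vderiv (cconj L) (complex_of_real \<circ> h) p = cnj (vderiv L (complex_of_real \<circ> h) p)"
    for L
    using assms(2) by (simp add: vderiv_def h cconj_def linear_neg)
  then show ?thesis
    by (simp add: dbar_b_def del_b_def F)
qed

text \<open>The subtracted products vanish because \<omega> annihilates \<open>cconj L'\<close>; the
  remaining double sum is the expansion of \<open>L\<close> and \<open>L'\<close> in the frame. The
  second slot is conjugate-linear in \<open>L'\<close>, hence the \<open>cnj\<close> in the last
  assumption.\<close>

lemma component11_eq:
  assumes S: "subspace (tangent_space d M p)"
    and L: "L \<in> T10 d M p" and L': "L' \<in> T10 d M p"
    and 1: "\<And>L'. L' \<in> T10 d M p \<Longrightarrow> clinear_on (T10 d M p) (\<lambda>L. \<beta> p L (cconj L'))"
    and 2: "clinear_on (T10 d M p) (\<lambda>L'. cnj (\<beta> p L (cconj L')))"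
  shows "component11 d M \<beta> p L (cconj L') = \<beta> p L (cconj L')"
proof -
  obtain B \<omega> where F: "CR_frame d M p = (B, \<omega>)" by fastforce
  note fr = CR_frame_correct[OF S F]
  have BT: "B \<subseteq> T10 d M p" using fr(1) by (simp add: orthonormal_frame_def)
  have 0: "\<omega> K (cconj L') = 0" if "K \<in> B" for K
    using fr(2) that L' by (auto simp: dual_frame_def T01_def)
  have "component11 d M \<beta> p L (cconj L') =
      (\<Sum>K'\<in>B. (\<Sum>K\<in>B. \<omega> K L * \<beta> p K (cconj K')) * cnj (\<omega> K' L'))"
    unfolding component11_def F sum_distrib_right
    by (subst sum.swap) (simp add: 0 mult_ac)
  also have "\<dots> = (\<Sum>K'\<in>B. \<beta> p L (cconj K') * cnj (\<omega> K' L'))"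
  proof (rule sum.cong[OF refl])
    fix K' assume "K' \<in> B"
    then have "(\<Sum>K\<in>B. \<omega> K L * \<beta> p K (cconj K')) = \<beta> p (\<Sum>K\<in>B. cscale (\<omega> K L) K) (cconj K')"
      using BT by (intro clinear_on_sum[OF 1 subspace_T10[OF S], symmetric]) auto
    then show "(\<Sum>K\<in>B. \<omega> K L * \<beta> p K (cconj K')) * cnj (\<omega> K' L') = \<beta> p L (cconj K') * cnj (\<omega> K' L')"
      using dual_frame_expansion[OF S fr L] by simp
  qed
  also have "\<dots> = cnj (\<Sum>K'\<in>B. \<omega> K' L' * cnj (\<beta> p L (cconj K')))"
    by (simp add: mult.commute)
  also have "(\<Sum>K'\<in>B. \<omega> K' L' * cnj (\<beta> p L (cconj K'))) =
      cnj (\<beta> p L (cconj (\<Sum>K'\<in>B. cscale (\<omega> K' L') K')))"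
    using BT by (intro clinear_on_sum[OF 2 subspace_T10[OF S], symmetric]) auto
  also have "(\<Sum>K'\<in>B. cscale (\<omega> K' L') K') = L'"
    using dual_frame_expansion[OF S fr L'] by simp
  finally show ?thesis by simp
qed

section \<open>Tangent spaces\<close>

lemma local_parametrization_subset: "local_parametrization M U \<phi> \<Longrightarrow> \<phi> ` U \<subseteq> M"
  unfolding local_parametrization_def using openin_imp_subset by blast

text \<open>The curve \<open>t \<mapsto> \<psi> (v + t b)\<close> is \<open>\<phi> (w t)\<close>. As \<open>D \<phi> u\<close> is bounded below, \<open>\<bar>w t - u\<bar> = O(t)\<close>, so the
  vectors \<open>D \<phi> u ((w t - u) / t)\<close> tend to \<open>D \<psi> v b\<close>. No differentiability of the transition map is
  needed.\<close>

lemma tangent_vector_transfer: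
  fixes \<phi> :: "real^'d \<Rightarrow> 'a::euclidean_space" and \<psi> :: "real^'e \<Rightarrow> 'a"
  assumes \<phi>: "local_parametrization M U \<phi>" and \<psi>: "local_parametrization M V \<psi>"
    and u: "u \<in> U" and v: "v \<in> V" and eq: "\<phi> u = \<psi> v"
  shows "D \<psi> v b \<in> range (D \<phi> u)"
proof -
  let ?y = "D \<psi> v b"
  have \<phi>': "(\<phi> has_derivative D \<phi> u) (at u)" and \<psi>': "(\<psi> has_derivative D \<psi> v) (at v)"
    using \<phi> \<psi> u v smooth_on_has_derivative unfolding local_parametrization_def by blast+
  have lin: "linear (D \<phi> u)" using \<phi>' by (rule has_derivative_linear)
  obtain \<theta> where \<theta>: "homeomorphism U (\<phi> ` U) \<phi> \<theta>" using \<phi> unfolding local_parametrization_def by blast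
  obtain O' where O': "open O'" "\<phi> ` U = M \<inter> O'"
    using \<phi> unfolding local_parametrization_def openin_open by blast
  obtain B where B: "B > 0" "\<And>x. B * norm x \<le> norm (D \<phi> u x)"
    using linear_inj_bounded_below_pos[OF lin] \<phi> u unfolding local_parametrization_def by blast
  define w where "w t = \<theta> (\<psi> (v + t *\<^sub>R b))" for t
  have lim_v: "((\<lambda>t. v + t *\<^sub>R b) \<longlongrightarrow> v) (at_right 0)"
    by (auto intro!: tendsto_eq_intros)
  have ev_V: "\<forall>\<^sub>F t in at_right 0. v + t *\<^sub>R b \<in> V"
    using \<psi> v unfolding local_parametrization_def by (intro topological_tendstoD[OF lim_v]) auto
  have "isCont \<psi> v" using \<psi>' has_derivative_continuous by blast
  from isCont_tendsto_compose[OF this lim_v]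
  have lim_\<psi>: "((\<lambda>t. \<psi> (v + t *\<^sub>R b)) \<longlongrightarrow> \<psi> v) (at_right 0)" .
  have \<psi>v: "\<psi> v \<in> \<phi> ` U" using u unfolding eq[symmetric] by (rule imageI)
  then have "\<forall>\<^sub>F t in at_right 0. \<psi> (v + t *\<^sub>R b) \<in> O'"
    using O' by (intro topological_tendstoD[OF lim_\<psi>]) auto
  with ev_V have ev_U: "\<forall>\<^sub>F t in at_right 0. \<psi> (v + t *\<^sub>R b) \<in> \<phi> ` U"
    by eventually_elim (use O' local_parametrization_subset[OF \<psi>] in auto)
  have lim_w: "(w \<longlongrightarrow> u) (at_right 0)"
  proof -
    have "((\<lambda>t. \<theta> (\<psi> (v + t *\<^sub>R b))) \<longlongrightarrow> \<theta> (\<psi> v)) (at_right 0)"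
      using \<theta> by (intro continuous_on_tendsto_compose[OF _ lim_\<psi> \<psi>v ev_U]) (rule homeomorphism_cont2)
    moreover have "\<theta> (\<psi> v) = u" unfolding eq[symmetric] by (rule homeomorphism_apply1[OF \<theta> u])
    ultimately show ?thesis unfolding w_def by simp
  qed
  have "?y \<in> closure (range (D \<phi> u))"
    unfolding closure_approachable
  proof (intro allI impI)
    fix e :: real assume e: "e > 0"
    \<comment> \<open>\<open>C\<close> bounds the difference quotients of the curve. The bound
      \<open>B / 2\<close> on \<delta> allows absorption below, the other one makes the error of
      \<open>\<phi>\<close> at most \<open>t * (e / 2)\<close>. With \<epsilon> the error of
      \<open>\<psi>\<close> is at most \<open>t * min 1 (e / 4)\<close>, where the 1 serves the
      bound by \<open>C\<close>. Altogether 3/4 of \<open>e\<close> is spent.\<close>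
    define C where "C = norm ?y + 1"
    define \<delta> where "\<delta> = min (B / 2) (e * B / (4 * C))"
    define \<epsilon> where "\<epsilon> = min 1 (e / 4) / (norm b + 1)"
    have C: "C > 0" by (simp add: C_def add_nonneg_pos)
    have \<delta>: "\<delta> > 0" using B e C by (simp add: \<delta>_def)
    have \<epsilon>: "\<epsilon> > 0" using e by (simp add: \<epsilon>_def add_nonneg_pos)
    obtain r where r: "r > 0" "\<And>z. norm (z - u) < r \<Longrightarrow> norm (\<phi> z - \<phi> u - D \<phi> u (z - u)) \<le> \<delta> * norm (z - u)"
      using \<phi>' \<delta> unfolding has_derivative_at_alt by blast
    obtain s where s: "s > 0" "\<And>z. norm (z - v) < s \<Longrightarrow> norm (\<psi> z - \<psi> v - D \<psi> v (z - v)) \<le> \<epsilon> * norm (z - v)"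
      using \<psi>' \<epsilon> unfolding has_derivative_at_alt by blast
    have "\<forall>\<^sub>F t in at_right 0. dist (v + t *\<^sub>R b) v < s" "\<forall>\<^sub>F t in at_right 0. dist (w t) u < r"
      using tendstoD[OF lim_v s(1)] tendstoD[OF lim_w r(1)] by auto
    moreover have "\<forall>\<^sub>F t in at_right (0::real). t > 0" by (simp add: eventually_at_filter)
    ultimately have "\<forall>\<^sub>F t in at_right 0. t > 0 \<and> dist (v + t *\<^sub>R b) v < s \<and> dist (w t) u < r
        \<and> \<psi> (v + t *\<^sub>R b) \<in> \<phi> ` U"
      using ev_U by eventually_elim auto
    from eventually_happens'[OF _ this] obtain t where t: "t > 0" "dist (v + t *\<^sub>R b) v < s"
      "dist (w t) u < r" "\<psi> (v + t *\<^sub>R b) \<in> \<phi> ` U"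
      by (auto simp: trivial_limit_at_right_real)
    have \<phi>w: "\<phi> (w t) = \<psi> (v + t *\<^sub>R b)"
      unfolding w_def by (rule homeomorphism_apply2[OF \<theta> t(4)])
    let ?d = "\<phi> (w t) - \<phi> u"
    have "norm (?d - t *\<^sub>R ?y) \<le> \<epsilon> * norm (t *\<^sub>R b)"
      using s(2)[of "v + t *\<^sub>R b"] t(2) has_derivative_linear[OF \<psi>']
      by (simp add: dist_norm \<phi>w eq linear_scale)
    also have "\<dots> = t * (\<epsilon> * norm b)" using t(1) by simp
    also have "\<dots> \<le> t * min 1 (e / 4)"
    proof -
      have "\<epsilon> * norm b \<le> \<epsilon> * (norm b + 1)" using \<epsilon> by (intro mult_left_mono) auto
      also have "\<dots> = min 1 (e / 4)"
        unfolding \<epsilon>_def by (metis add_nonneg_pos less_numeral_extra(1,3) nonzero_eq_divide_eq norm_ge_zero)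
      finally show ?thesis using t(1) by simp
    qed
    finally have 1: "norm (?d - t *\<^sub>R ?y) \<le> t * min 1 (e / 4)" .
    also have "\<dots> \<le> t * 1" using t(1) by (intro mult_left_mono) auto
    finally have "norm (?d - t *\<^sub>R ?y) \<le> t" by simp
    then have "norm ?d \<le> t + norm (t *\<^sub>R ?y)"
      using norm_triangle_ineq[of "?d - t *\<^sub>R ?y" "t *\<^sub>R ?y"] by simp
    then have 2: "norm ?d \<le> t * C" using t(1) by (simp add: C_def algebra_simps)
    have 3: "norm (?d - D \<phi> u (w t - u)) \<le> \<delta> * norm (w t - u)"
      using r(2) t(3) by (simp add: dist_norm)
    \<comment> \<open>Half of the lower bound \<open>B * norm (w t - u)\<close> absorbs the
      linearization error; what remains gives |w t - u| = O(t).\<close>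
    also have "\<dots> \<le> B / 2 * norm (w t - u)" by (intro mult_right_mono) (auto simp: \<delta>_def)
    finally have "B * norm (w t - u) \<le> norm ?d + B / 2 * norm (w t - u)"
      using B(2)[of "w t - u"] norm_triangle_ineq2[of "D \<phi> u (w t - u)" ?d] norm_minus_commute[of ?d "D \<phi> u (w t - u)"]
      by simp
    then have "B * norm (w t - u) \<le> 2 * (t * C)" using 2 by simp
    then have 4: "norm (w t - u) \<le> 2 * (t * C) / B" using B(1) by (simp add: field_simps)
    have "\<delta> * norm (w t - u) \<le> (e * B / (4 * C)) * (2 * (t * C) / B)"
      using 4 e B(1) C by (intro mult_mono) (auto simp: \<delta>_def)
    also have "\<dots> = t * (e / 2)" using B(1) C by (simp add: field_simps)
    finally have 5: "norm (?d - D \<phi> u (w t - u)) \<le> t * (e / 2)" using 3 by simp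
    have "norm (D \<phi> u (w t - u) - t *\<^sub>R ?y) \<le> t * (e / 2) + t * (e / 4)"
    proof -
      have "t * min 1 (e / 4) \<le> t * (e / 4)" using t(1) by (intro mult_left_mono) auto
      moreover have "norm (D \<phi> u (w t - u) - t *\<^sub>R ?y) \<le> norm (D \<phi> u (w t - u) - ?d) + norm (?d - t *\<^sub>R ?y)"
        using norm_triangle_ineq[of "D \<phi> u (w t - u) - ?d" "?d - t *\<^sub>R ?y"] by simp
      ultimately show ?thesis
        using 1 5 unfolding norm_minus_commute[of ?d "D \<phi> u (w t - u)"] by linarith
    qed
    also have "\<dots> < t * e" using t(1) e by (simp add: field_simps)
    finally have 6: "norm (D \<phi> u (w t - u) - t *\<^sub>R ?y) < t * e" .
    have "D \<phi> u ((1 / t) *\<^sub>R (w t - u)) - ?y = (1 / t) *\<^sub>R (D \<phi> u (w t - u) - t *\<^sub>R ?y)"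
      using t(1) unfolding linear_scale[OF lin] by (simp add: scaleR_diff_right)
    then have "dist (D \<phi> u ((1 / t) *\<^sub>R (w t - u))) ?y = norm (D \<phi> u (w t - u) - t *\<^sub>R ?y) / t"
      using t(1) by (simp add: dist_norm)
    also have "\<dots> < e" using 6 t(1) by (simp add: field_simps)
    finally show "\<exists>z\<in>range (D \<phi> u). dist z ?y < e" by blast
  qed
  \<comment> \<open>A linear subspace of a Euclidean space is closed, so it suffices to have
    approximated the vector.\<close>
  moreover have "closed (range (D \<phi> u))"
    using linear_subspace_image[OF lin subspace_UNIV] by (intro closed_subspace) auto
  ultimately show ?thesis by (simp add: closure_closed)
qed

text \<open>The definition unites the ranges over all charts through \<open>p\<close>. By
  \<open>tangent_vector_transfer\<close> these ranges coincide, so any single chart computes the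
  tangent space, which is therefore a subspace.\<close>

lemma tangent_space_eq:
  fixes \<phi> :: "real^'d \<Rightarrow> 'a::euclidean_space"
  assumes "local_parametrization M U \<phi>" "u \<in> U" "\<phi> u = p"
  shows "tangent_space TYPE('d) M p = range (D \<phi> u)"
proof
  show "tangent_space TYPE('d) M p \<subseteq> range (D \<phi> u)"
  proof
    fix x assume "x \<in> tangent_space TYPE('d) M p"
    then obtain V and \<psi> :: "real^'d \<Rightarrow> 'a" and v b where
      "local_parametrization M V \<psi>" "v \<in> V" "\<psi> v = p" "x = D \<psi> v b"
      unfolding tangent_space_def by blast
    then show "x \<in> range (D \<phi> u)"
      using tangent_vector_transfer[OF assms(1) _ assms(2), of V \<psi> v b] assms(3) by simp
  qed
  show "range (D \<phi> u) \<subseteq> tangent_space TYPE('d) M p"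
    using assms unfolding tangent_space_def by blast
qed

lemma local_parametrization_linear:
  "local_parametrization M U \<phi> \<Longrightarrow> u \<in> U \<Longrightarrow> linear (D \<phi> u)"
  using smooth_on_linear_D unfolding local_parametrization_def by blast

lemma smooth_submanifold_chart:
  fixes M :: "'a::euclidean_space set"
  assumes "smooth_submanifold TYPE('d::finite) M" "p \<in> M"
  obtains U and \<phi> :: "real^'d \<Rightarrow> 'a" and u where "local_parametrization M U \<phi>" "u \<in> U" "\<phi> u = p"
  using assms unfolding smooth_submanifold_def by (metis imageE)

lemma subspace_tangent_space:
  fixes M :: "'a::euclidean_space set"
  assumes "smooth_submanifold TYPE('d::finite) M" "p \<in> M"
  shows "subspace (tangent_space TYPE('d) M p)"
proof -
  obtain U and \<phi> :: "real^'d \<Rightarrow> 'a" and u where \<phi>: "local_parametrization M U \<phi>" "u \<in> U" "\<phi> u = p"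
    by (rule smooth_submanifold_chart[OF assms])
  show ?thesis
    unfolding tangent_space_eq[OF \<phi>]
    by (rule linear_subspace_image[OF local_parametrization_linear[OF \<phi>(1,2)] subspace_UNIV])
qed

lemma chart_at_correct:
  fixes M :: "'a::euclidean_space set"
  assumes "smooth_submanifold TYPE('d::finite) M" "p \<in> M" "chart_at TYPE('d) M p = (\<phi>, u)"
  obtains U where "local_parametrization M U \<phi>" "u \<in> U" "\<phi> u = p"
proof -
  have "\<exists>x. case x of (\<phi> :: real^'d \<Rightarrow> 'a, u) \<Rightarrow> \<exists>U. local_parametrization M U \<phi> \<and> u \<in> U \<and> \<phi> u = p"
    by (rule smooth_submanifold_chart[OF assms(1,2)]) auto
  from someI_ex[OF this] assms(3) that show thesis unfolding chart_at_def by auto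
qed

text \<open>Smoothness is only known in charts; composing with the continuous inverse of a chart,
  whose image is relatively open, gives continuity on \<open>M\<close> itself. It serves to bound
  \<open>T\<close> on a compact \<open>M\<close>.\<close>

lemma smooth_vector_field_continuous_on:
  fixes M :: "'a::euclidean_space set"
  assumes M: "smooth_submanifold TYPE('d::finite) M" and T: "smooth_vector_field TYPE('d) M T"
  shows "continuous_on M T"
  unfolding continuous_on_eq_continuous_within
proof
  fix p assume "p \<in> M"
  then obtain U and \<phi> :: "real^'d \<Rightarrow> 'a" where \<phi>: "local_parametrization M U \<phi>" "p \<in> \<phi> ` U"
    using M unfolding smooth_submanifold_def by blast
  obtain \<theta> where \<theta>: "homeomorphism U (\<phi> ` U) \<phi> \<theta>" using \<phi> unfolding local_parametrization_def by blast
  obtain O' where O': "open O'" "\<phi> ` U = M \<inter> O'"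
    using \<phi> unfolding local_parametrization_def openin_open by blast
  have "continuous_on U (T \<circ> \<phi>)"
    using T \<phi>(1) smooth_on_continuous unfolding smooth_vector_field_def by blast
  then have "continuous_on (\<phi> ` U) ((T \<circ> \<phi>) \<circ> \<theta>)"
    by (intro continuous_on_compose[of _ \<theta> "T \<circ> \<phi>"] homeomorphism_cont2[OF \<theta>])
       (simp only: homeomorphism_image2[OF \<theta>])
  moreover have "((T \<circ> \<phi>) \<circ> \<theta>) q = T q" if "q \<in> \<phi> ` U" for q
    using homeomorphism_apply2[OF \<theta> that] by simp
  ultimately have "continuous_on (\<phi> ` U) T" by (rule continuous_on_eq)
  then have "continuous (at p within \<phi> ` U) T"
    using \<phi>(2) unfolding continuous_on_eq_continuous_within by blast
  moreover have "at p within \<phi> ` U = at p within M"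
    using O' \<phi>(2) by (intro at_within_nhd[of p O']) auto
  ultimately show "continuous (at p within M) T" by simp
qed

text \<open>The sum of the absolute partial derivatives is continuous, hence bounded on
  \<open>M\<close>, and dominates the operator norm of \<open>D h p\<close>.\<close>

lemma D_bounded_on_compact:
  fixes h :: "'a::euclidean_space \<Rightarrow> real"
  assumes h: "smooth_on UNIV h" and M: "compact M"
  obtains C where "C \<ge> 0" "\<And>p v. p \<in> M \<Longrightarrow> \<bar>D h p v\<bar> \<le> C * norm v"
proof -
  have "continuous_on M (\<lambda>p. D h p e)" for e
    using smooth_on_continuous[OF smooth_on_D[OF h]] continuous_on_subset by blast
  then have "compact ((\<lambda>p. \<Sum>e\<in>Basis. \<bar>D h p e\<bar>) ` M)"
    by (intro compact_continuous_image M continuous_intros)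
  then have "bounded ((\<lambda>p. \<Sum>e\<in>Basis. \<bar>D h p e\<bar>) ` M)" by (rule compact_imp_bounded)
  then obtain C where C: "C > 0" "\<And>p. p \<in> M \<Longrightarrow> \<bar>\<Sum>e\<in>Basis. \<bar>D h p e\<bar>\<bar> \<le> C"
    unfolding bounded_pos by auto
  have "\<bar>D h p v\<bar> \<le> C * norm v" if p: "p \<in> M" for p v
  proof -
    have "D h p v = (\<Sum>e\<in>Basis. (v \<bullet> e) * D h p e)"
      using linear_basis_expansion[OF smooth_on_linear_D[OF h, of p], of v] by simp
    also have "\<bar>\<dots>\<bar> \<le> (\<Sum>e\<in>Basis. norm v * \<bar>D h p e\<bar>)"
      by (rule order_trans[OF sum_abs sum_mono]) (auto simp: abs_mult intro: mult_right_mono Basis_le_norm)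
    also have "\<dots> = norm v * (\<Sum>e\<in>Basis. \<bar>D h p e\<bar>)" by (simp add: sum_distrib_left)
    also have "\<dots> \<le> norm v * C" using C(2)[OF p] by (intro mult_left_mono) simp_all
    finally show ?thesis by (simp add: mult.commute)
  qed
  then show thesis using that[of C] C(1) by simp
qed

section \<open>The characteristic form\<close>

lemma differentiable_det:
  fixes A :: "'a::real_normed_vector \<Rightarrow> real^'n^'n"
  assumes "\<And>i j. (\<lambda>x. A x $ i $ j) differentiable (at x)"
  shows "(\<lambda>x. det (A x)) differentiable (at x)"
proof -
  have "((\<lambda>x. A x $ i $ j) has_derivative D (\<lambda>x. A x $ i $ j) x) (at x)" for i j
    using assms frechet_derivative_works by blast
  then have "(\<lambda>x. \<Prod>i\<in>UNIV. A x $ i $ p i) differentiable (at x)" for p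
    by (intro differentiableI[OF has_derivative_prod[of UNIV "\<lambda>i x. A x $ i $ p i"]])
  then show ?thesis
    unfolding det_def by (intro differentiable_sum differentiable_mult) simp_all
qed

text \<open>In the basis \<open>E y (axis k 1)\<close> of the range, the coordinates of the
  representer solve a linear system whose matrix is the Gram matrix \<open>A y\<close>. Cramer's
  rule writes them as quotients of determinants of differentiable entries.\<close>

lemma riesz_representer_differentiable:
  fixes E :: "'x::real_normed_vector \<Rightarrow> real^'d \<Rightarrow> 'a::euclidean_space" and c :: "'x \<Rightarrow> real^'d \<Rightarrow> real"
  assumes lin: "\<And>y. y \<in> U \<Longrightarrow> linear (E y)" "\<And>y. y \<in> U \<Longrightarrow> inj (E y)" "\<And>y. y \<in> U \<Longrightarrow> linear (c y)"
    and diff: "\<And>b. (\<lambda>y. E y b) differentiable (at x)" "\<And>b. (\<lambda>y. c y b) differentiable (at x)"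
    and x: "x \<in> U"
  obtains G where "\<And>y. y \<in> U \<Longrightarrow> G y \<in> range (E y)" "\<And>y b. y \<in> U \<Longrightarrow> E y b \<bullet> G y = c y b"
    "G differentiable (at x)"
proof -
  define A :: "'x \<Rightarrow> real^'d^'d" where "A y = (\<chi> i j. E y (axis i 1) \<bullet> E y (axis j 1))" for y
  define B :: "'x \<Rightarrow> 'd \<Rightarrow> real^'d^'d"
    where "B y k = (\<chi> i j. if j = k then c y (axis i 1) else A y $ i $ j)" for y k
  define s where "s y = (\<chi> k. det (B y k) / det (A y))" for y
  define G where "G y = (\<Sum>k\<in>UNIV. (s y $ k) *\<^sub>R E y (axis k 1))" for y
  have expand: "f v = (\<Sum>k\<in>UNIV. (v $ k) *\<^sub>R f (axis k 1))" if "linear f" for f :: "real^'d \<Rightarrow> 'z::real_vector" and v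
  proof -
    have "v = (\<Sum>k\<in>UNIV. (v $ k) *\<^sub>R axis k 1)" using basis_expansion[of v] by (simp add: scalar_mult_eq_scaleR)
    then have "f v = f (\<Sum>k\<in>UNIV. (v $ k) *\<^sub>R axis k 1)" by simp
    then show ?thesis using that by (simp add: linear_sum linear_scale)
  qed
  have Ax: "(A y *v v) $ i = E y (axis i 1) \<bullet> E y v" if "y \<in> U" for y v i
    unfolding expand[OF lin(1)[OF that], of v]
    by (simp add: A_def matrix_vector_mult_def inner_sum_right mult.commute)
  have det: "det (A y) \<noteq> 0" if "y \<in> U" for y
  proof -
    \<comment> \<open>The quadratic form of the Gram matrix at \<open>v\<close> is the squared norm
      of \<open>E y v\<close>, and \<open>E y\<close> is injective.\<close>
    have "v = 0" if v: "A y *v v = 0" for v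
    proof -
      have "E y v \<bullet> E y v = (\<Sum>i\<in>UNIV. v $ i * (A y *v v) $ i)"
        unfolding Ax[OF \<open>y \<in> U\<close>] by (subst expand[OF lin(1)[OF \<open>y \<in> U\<close>], of v]) (simp add: inner_sum_left)
      then have "E y v = 0" using v by simp
      then show "v = 0" using lin(1,2)[OF \<open>y \<in> U\<close>] by (metis injD linear_0)
    qed
    then have "inj ((*v) (A y))"
      using linear_injective_0[OF matrix_vector_mul_linear, of "A y"] by blast
    then show ?thesis using det_nz_iff_inj[OF matrix_vector_mul_linear, of "A y"] by simp
  qed
  have "A y *v s y = (\<chi> i. c y (axis i 1))" if "y \<in> U" for y
    unfolding cramer[OF det[OF that]] s_def B_def by (simp add: vec_eq_iff cong: if_cong)
  then have As: "(A y *v s y) $ i = c y (axis i 1)" if "y \<in> U" for y i using that by simp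
  have G: "G y = E y (s y)" if "y \<in> U" for y
    unfolding G_def by (rule expand[OF lin(1)[OF that], symmetric])
  have "E y b \<bullet> G y = c y b" if "y \<in> U" for y b
    by (subst expand[OF lin(1)[OF that], of b], subst expand[OF lin(3)[OF that], of b])
       (simp add: inner_sum_left G[OF that] Ax[OF that, symmetric] As[OF that])
  moreover have "G differentiable (at x)"
  proof -
    have A: "(\<lambda>y. A y $ i $ j) differentiable (at x)" for i j
      using diff(1) by (simp add: A_def differentiable_inner)
    have "(\<lambda>y. B y k $ i $ j) differentiable (at x)" for k i j
      using A diff(2) by (cases "j = k") (simp_all add: B_def)
    then have "(\<lambda>y. s y $ k) differentiable (at x)" for k
      using det[OF x] A by (simp add: s_def differentiable_det differentiable_divide)
    then have "\<forall>k\<in>UNIV. (\<lambda>y. (s y $ k) *\<^sub>R E y (axis k 1)) differentiable (at x)"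
      by (intro ballI differentiable_scaleR diff)
    then show ?thesis unfolding G_def by (intro differentiable_sum) simp_all
  qed
  ultimately show thesis using G by (intro that) auto
qed

lemma cvec_subspace_T01:
  assumes "subspace (tangent_space d M p)"
  shows "cvec.subspace (T01 d M p)"
  unfolding cvec.subspace_def
proof (intro conjI ballI allI)
  note S = subspace_T10[OF assms]
  show "0 \<in> T01 d M p"
    using cvec.subspace_0[OF S] by (auto simp: T01_def cconj_def image_iff zero_prod_def intro!: bexI[of _ 0])
  show "V + W \<in> T01 d M p" if "V \<in> T01 d M p" "W \<in> T01 d M p" for V W
    using that cvec.subspace_add[OF S] unfolding T01_def by (auto simp flip: cconj_add)
  show "cscale c V \<in> T01 d M p" if "V \<in> T01 d M p" for c V
    using that cvec.subspace_scale[OF S, of _ "cnj c"] unfolding T01_def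
    by (auto simp: image_iff cconj_cscale intro!: bexI[of _ "cscale (cnj c) _"])
qed

lemma T10_subset_CT: "T10 d M p \<subseteq> CT d M p"
  by (simp add: T10_def)

lemma T01_subset_CT: "subspace (tangent_space d M p) \<Longrightarrow> T01 d M p \<subseteq> CT d M p"
  using cconj_CT T10_subset_CT unfolding T01_def by blast

section \<open>The characteristic form and \<open>del_b\<close> on real tangent vectors at one
  point\<close>

context
  fixes M :: "(complex^'N) set" and \<gamma> :: "(complex^'N) form1" and d :: "'d::finite itself"
    and T :: "complex^'N \<Rightarrow> (complex^'N) \<times> (complex^'N)" and p :: "complex^'N"
  assumes char: "characteristic_form d M \<gamma> T" and p: "p \<in> M"
    and S: "subspace (tangent_space d M p)"
begin

lemma clinear_on_characteristic_form: "clinear_on (CT d M p) (\<gamma> p)"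
  using char p by (simp add: characteristic_form_def smooth_form1_def)

lemma real_vector_CT: "v \<in> tangent_space d M p \<Longrightarrow> (v, 0) \<in> CT d M p"
  using subspace_0[OF S] by (simp add: CT_def)

lemma characteristic_form_imaginary:
  assumes "v \<in> tangent_space d M p"
  shows "\<gamma> p (v, 0) = \<i> * complex_of_real (Im (\<gamma> p (v, 0)))"
proof -
  have "cnj (\<gamma> p (cconj (v, 0))) = - \<gamma> p (v, 0)"
    using char p real_vector_CT[OF assms] unfolding characteristic_form_def by blast
  then show ?thesis by (simp add: cconj_def complex_eq_iff)
qed

lemma clinear_on_CT_split:
  assumes "clinear_on (CT d M p) \<alpha>" "V \<in> CT d M p"
  shows "\<alpha> V = \<alpha> (fst V, 0) + \<i> * \<alpha> (snd V, 0)"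
proof -
  have "V = (fst V, 0) + cscale \<i> (snd V, 0)" by (simp add: cscale_def prod_eq_iff)
  moreover have "(fst V, 0) \<in> CT d M p" "(snd V, 0) \<in> CT d M p"
    using assms(2) real_vector_CT by (auto simp: CT_def)
  ultimately show ?thesis
    using clinear_on_add[OF assms(1)] clinear_on_cscale[OF assms(1)] cvec.subspace_scale[OF subspace_CT[OF S]]
    by metis
qed

text \<open>The vector is the (1,0) part of \<open>w\<close>. Write \<open>(w, 0)\<close> as V + W +
  k T with V in \<open>T10\<close> and W in \<open>T01\<close>: applying \<gamma> gives k = 0. In
  particular the real kernel of \<gamma> is invariant under \<open>J\<close>.\<close>

lemma horizontal_vector_T10:
  assumes w: "w \<in> tangent_space d M p" and \<gamma>w: "\<gamma> p (w, 0) = 0"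
  shows "((1/2) *\<^sub>R w, - ((1/2) *\<^sub>R J w)) \<in> T10 d M p"
proof -
  have span: "cvec.span (insert (T p) (T10 d M p \<union> T01 d M p)) = CT d M p"
    and T: "\<gamma> p (T p) = -1" "T p \<in> CT d M p"
    and 0: "\<And>V. V \<in> T10 d M p \<union> T01 d M p \<Longrightarrow> \<gamma> p V = 0"
    using char p unfolding characteristic_form_def smooth_vector_field_def by auto
  have "(w, 0) \<in> cvec.span (insert (T p) (T10 d M p \<union> T01 d M p))"
    unfolding span by (rule real_vector_CT[OF w])
  then obtain k where "(w, 0) - cscale k (T p) \<in> cvec.span (T10 d M p \<union> T01 d M p)"
    unfolding cvec.span_insert by blast
  moreover have "cvec.span (T10 d M p) = T10 d M p" "cvec.span (T01 d M p) = T01 d M p"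
    using subspace_T10[OF S] cvec_subspace_T01[OF S] by (simp_all only: cvec.span_eq_iff)
  ultimately obtain V W where VW: "V \<in> T10 d M p" "W \<in> T01 d M p" "(w, 0) - cscale k (T p) = V + W"
    unfolding cvec.span_Un by auto
  have CT: "V \<in> CT d M p" "W \<in> CT d M p"
    using VW(1,2) T10_subset_CT T01_subset_CT[OF S] by blast+
  note lin = clinear_on_characteristic_form
  have eq: "(w, 0) = V + W + cscale k (T p)" using VW(3) by (simp add: algebra_simps)
  have "\<gamma> p (V + W + cscale k (T p)) = \<gamma> p V + \<gamma> p W + k * \<gamma> p (T p)"
    using CT T(2) subspace_CT[OF S]
    by (simp add: clinear_on_add[OF lin] clinear_on_cscale[OF lin] cvec.subspace_add cvec.subspace_scale)
  then have "k = 0" using \<gamma>w 0 VW(1,2) T(1) unfolding eq by simp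
  then have eq: "(w, 0) = V + W" using eq by simp
  obtain V' where V': "V' \<in> T10 d M p" "W = cconj V'" using VW(2) by (auto simp: T01_def)
  \<comment> \<open>\<open>(w, 0)\<close> has no imaginary part, so those of \<open>V\<close> and
    \<open>cconj V'\<close> cancel. Since \<open>J\<close> is injective, \<open>V\<close> equals
    \<open>V'\<close>, and \<open>w\<close> is twice its real part.\<close>
  have "snd V = snd V'" using eq V'(2) by (simp add: cconj_def prod_eq_iff)
  then have "J (fst V) = J (fst V')" using T10_D(2)[OF VW(1)] T10_D(2)[OF V'(1)] by simp
  then have "fst V = fst V'" by (metis J_J neg_equal_iff_equal)
  then have "w = fst V + fst V" using eq V'(2) by (simp add: cconj_def prod_eq_iff)
  then have "fst V = (1/2) *\<^sub>R w" by (simp flip: scaleR_2)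
  then have "V = ((1/2) *\<^sub>R w, - ((1/2) *\<^sub>R J w))"
    using T10_D(2)[OF VW(1)] by (simp add: prod_eq_iff J_scaleR)
  then show ?thesis using VW(1) by simp
qed

context
  fixes G :: "complex^'N"
  assumes G: "G \<in> tangent_space d M p" "\<And>v. v \<in> tangent_space d M p \<Longrightarrow> v \<bullet> G = Im (\<gamma> p (v, 0))"
begin

lemma characteristic_form_real: "v \<in> tangent_space d M p \<Longrightarrow> \<gamma> p (v, 0) = \<i> * complex_of_real (v \<bullet> G)"
  using characteristic_form_imaginary[of v] G(2) by simp

text \<open>\<open>T p\<close> is \<i>t for a real tangent vector t, and \<gamma>(\<i>t) = -(t
  \<bullet> G). The normalization therefore reads t \<bullet> G = 1, and Cauchy-Schwarz applies.
  This keeps \<open>G\<close> quantitatively away from 0.\<close>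

lemma representer_norm_ge: "1 \<le> norm (T p) * norm G"
proof -
  have T: "cconj (T p) = - T p" "\<gamma> p (T p) = -1" "T p \<in> CT d M p"
    using char p unfolding characteristic_form_def smooth_vector_field_def by auto
  have "fst (T p) = - fst (T p)" using T(1) by (simp add: cconj_def prod_eq_iff)
  then have "2 *\<^sub>R fst (T p) = 0" unfolding scaleR_2 by (simp only: add_eq_0_iff)
  then have fst: "fst (T p) = 0" by (simp only: scaleR_eq_0_iff) simp
  have t: "snd (T p) \<in> tangent_space d M p" using T(3) by (auto simp: CT_def)
  have "\<gamma> p (T p) = - complex_of_real (snd (T p) \<bullet> G)"
    unfolding clinear_on_CT_split[OF clinear_on_characteristic_form T(3)] fst
      characteristic_form_real[OF subspace_0[OF S]] characteristic_form_real[OF t] by simp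
  then have "complex_of_real (snd (T p) \<bullet> G) = 1" using T(2) by simp
  then have "1 = snd (T p) \<bullet> G" by (metis of_real_eq_1_iff)
  also have "\<dots> \<le> norm (snd (T p)) * norm G" by (rule norm_cauchy_schwarz)
  also have "\<dots> \<le> norm (T p) * norm G" using norm_snd_le[of "snd (T p)" "fst (T p)"] by (intro mult_right_mono) auto
  finally show ?thesis .
qed

lemma representer_nonzero: "G \<noteq> 0"
  using representer_norm_ge by auto

text \<open>\<gamma> is imaginary on real vectors, so \<gamma>(V) = 0 splits into one real equation
  for each component of \<open>V\<close>.\<close>

lemma representer_orthogonal:
  assumes "V \<in> T10 d M p \<union> T01 d M p"
  shows "fst V \<bullet> G = 0" "snd V \<bullet> G = 0"
proof -
  have V: "V \<in> CT d M p" using assms T10_subset_CT T01_subset_CT[OF S] by blast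
  have "\<gamma> p V = 0" using char p assms unfolding characteristic_form_def by blast
  then have "\<i> * complex_of_real (fst V \<bullet> G) - complex_of_real (snd V \<bullet> G) = 0"
    using clinear_on_CT_split[OF clinear_on_characteristic_form V] V
    by (simp add: CT_def mem_Times_iff characteristic_form_real)
  then show "fst V \<bullet> G = 0" "snd V \<bullet> G = 0" by (auto simp: complex_eq_iff)
qed

text \<open>\<open>w\<close> is the projection of \<open>v\<close> orthogonal to \<open>G\<close>,
  and \<open>(v, 0)\<close> is the sum of its (1,0) part, the conjugate of that part and a multiple
  of \<open>(G, 0)\<close>. Only the first summand contributes, by \<open>vderiv\<close>. The local
  \<kappa> is the coefficient of \<open>G\<close>, not the \<kappa> of the overview.\<close>

lemma del_b_real_vector:
  fixes f :: "complex^'N \<Rightarrow> complex"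
  assumes f: "linear (D f p)" and v: "v \<in> tangent_space d M p"
  defines "w \<equiv> v - ((v \<bullet> G) / (G \<bullet> G)) *\<^sub>R G"
  shows "del_b d M f p (v, 0) = (D f p w - \<i> * D f p (J w)) / 2"
proof -
  define \<kappa> where "\<kappa> = complex_of_real ((v \<bullet> G) / (G \<bullet> G))"
  define L where "L = ((1/2) *\<^sub>R w, - ((1/2) *\<^sub>R J w))"
  have w: "w \<in> tangent_space d M p"
    unfolding w_def by (intro subspace_diff[OF S] subspace_scale[OF S] v G(1))
  have "w \<bullet> G = 0" using representer_nonzero by (simp add: w_def inner_diff_left)
  then have "\<gamma> p (w, 0) = 0" using characteristic_form_real[OF w] by simp
  then have L: "L \<in> T10 d M p" unfolding L_def by (rule horizontal_vector_T10[OF w])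
  then have L': "cconj L \<in> T01 d M p" by (simp add: T01_def)
  have Gorth: "(G, 0) \<in> CR_orth_complement d M p"
    unfolding CR_orth_complement_def
    using real_vector_CT[OF G(1)] representer_orthogonal
    by (auto simp: hinner_def zero_complex.code inner_commute)
  have CT: "L \<in> CT d M p" "cconj L \<in> CT d M p" "(G, 0) \<in> CT d M p"
    using L L' T10_subset_CT T01_subset_CT[OF S] real_vector_CT[OF G(1)] by blast+
  have "(v, 0) = L + cconj L + cscale \<kappa> (G, 0)"
    unfolding \<kappa>_def cscale_of_real
    by (simp add: L_def cconj_def w_def flip: scaleR_left_distrib)
  also have "del_b d M f p \<dots> = del_b d M f p L + del_b d M f p (cconj L) + \<kappa> * del_b d M f p (G, 0)"
    using CT subspace_CT[OF S] clinear_on_del_b[OF S]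
    by (simp add: clinear_on_add[where S = "CT d M p"] clinear_on_cscale[where S = "CT d M p"] cvec.subspace_add cvec.subspace_scale)
  also have "\<dots> = vderiv L f p"
    using del_b_T10[OF S f L] del_b_eq_0[OF S, of "cconj L"] del_b_eq_0[OF S, of "(G, 0)"] L' Gorth by simp
  also have "\<dots> = (D f p w - \<i> * D f p (J w)) / 2"
    using linear_neg[OF f] linear_scale[OF f] by (simp add: vderiv_def L_def scaleR_conv_of_real diff_divide_distrib)
  finally show ?thesis .
qed

end
end

section \<open>Exterior derivatives in a chart\<close>

lemma ext_deriv_real_chart:
  assumes "chart_at d M p = (\<phi>, u)" "inj (D \<phi> u)"
  shows "ext_deriv_real d M \<alpha> p (D \<phi> u a) (D \<phi> u b) = D (pullback \<phi> \<alpha> b) u a - D (pullback \<phi> \<alpha> a) u b"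
  using assms by (simp add: ext_deriv_real_def)

lemma pullback_linear:
  fixes \<phi> :: "real^'d \<Rightarrow> 'a::euclidean_space"
  assumes M: "smooth_submanifold TYPE('d::finite) M" and \<phi>: "local_parametrization M U \<phi>" and y: "y \<in> U"
    and \<alpha>: "clinear_on (CT TYPE('d) M (\<phi> y)) (\<alpha> (\<phi> y))"
  shows "linear (\<lambda>b. pullback \<phi> \<alpha> b y)"
proof -
  have CT: "(D \<phi> y b, 0) \<in> CT TYPE('d) M (\<phi> y)" for b
    unfolding CT_def tangent_space_eq[OF \<phi> y refl]
    using linear_0[OF local_parametrization_linear[OF \<phi> y]] by (auto simp: image_iff)
  show ?thesis
  proof (rule linearI)
    show "pullback \<phi> \<alpha> (a + b) y = pullback \<phi> \<alpha> a y + pullback \<phi> \<alpha> b y" for a b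
      using clinear_on_add[OF \<alpha> CT CT, of a b] linear_add[OF local_parametrization_linear[OF \<phi> y]]
      by (simp add: pullback_def)
    show "pullback \<phi> \<alpha> (r *\<^sub>R a) y = r *\<^sub>R pullback \<phi> \<alpha> a y" for r a
      using clinear_on_cscale[OF \<alpha> CT, of "complex_of_real r" a] linear_scale[OF local_parametrization_linear[OF \<phi> y]]
      by (simp add: pullback_def cscale_of_real scaleR_conv_of_real)
  qed
qed

text \<open>Linearity in the parameter \<open>b\<close> holds on a neighbourhood of
  \<open>u\<close>, so it survives differentiation in the point.\<close>

lemma D_linear_family:
  assumes U: "open U" "u \<in> U" and lin: "\<And>y. y \<in> U \<Longrightarrow> linear (\<lambda>b. f b y)"
    and diff: "\<And>b. f b differentiable (at u)"
  shows "linear (\<lambda>b. D (f b) u a)"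
proof (rule linearI)
  have h: "(f b has_derivative D (f b) u) (at u)" for b
    using diff frechet_derivative_works by blast
  fix b c and r :: real
  have "(f (b + c) has_derivative (\<lambda>a. D (f b) u a + D (f c) u a)) (at u)"
    by (rule has_derivative_transform_within_open[OF has_derivative_add[OF h h] U])
       (simp add: linear_add[OF lin])
  from D_eqI[OF this] show "D (f (b + c)) u a = D (f b) u a + D (f c) u a" by simp
  have "(f (r *\<^sub>R b) has_derivative (\<lambda>a. r *\<^sub>R D (f b) u a)) (at u)"
    by (rule has_derivative_transform_within_open[OF has_derivative_scaleR_right[OF h] U])
       (simp add: linear_scale[OF lin])
  from D_eqI[OF this] show "D (f (r *\<^sub>R b)) u a = r *\<^sub>R D (f b) u a" by simp
qed

lemma ext_deriv_real_bilinear: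
  fixes \<phi> :: "real^'d \<Rightarrow> 'a::euclidean_space"
  assumes M: "smooth_submanifold TYPE('d::finite) M" and \<phi>: "local_parametrization M U \<phi>"
    and u: "u \<in> U" "\<phi> u = p" and chart: "chart_at TYPE('d) M p = (\<phi>, u)"
    and \<alpha>: "\<And>q. q \<in> M \<Longrightarrow> clinear_on (CT TYPE('d) M q) (\<alpha> q)"
    and diff: "\<And>b. pullback \<phi> \<alpha> b differentiable (at u)"
    and S: "v \<in> tangent_space TYPE('d) M p" "w \<in> tangent_space TYPE('d) M p" "x \<in> tangent_space TYPE('d) M p"
  shows "ext_deriv_real TYPE('d) M \<alpha> p (v + w) x = ext_deriv_real TYPE('d) M \<alpha> p v x + ext_deriv_real TYPE('d) M \<alpha> p w x"
    "ext_deriv_real TYPE('d) M \<alpha> p (r *\<^sub>R v) x = complex_of_real r * ext_deriv_real TYPE('d) M \<alpha> p v x"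
    "ext_deriv_real TYPE('d) M \<alpha> p x v = - ext_deriv_real TYPE('d) M \<alpha> p v x"
proof -
  have U: "open U" and inj: "inj (D \<phi> u)" using \<phi> u(1) unfolding local_parametrization_def by auto
  note \<phi>lin = local_parametrization_linear[OF \<phi> u(1)]
  have "linear (\<lambda>b. pullback \<phi> \<alpha> b y)" if "y \<in> U" for y
    using local_parametrization_subset[OF \<phi>] that by (intro pullback_linear[OF M \<phi> that] \<alpha>) auto
  then have 1: "linear (\<lambda>b. D (pullback \<phi> \<alpha> b) u a)" for a
    by (intro D_linear_family[OF U u(1) _ diff])
  have 2: "linear (D (pullback \<phi> \<alpha> b) u)" for b
    using diff[of b] unfolding frechet_derivative_works by (rule has_derivative_linear)
  note ext = ext_deriv_real_chart[OF chart inj]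
  obtain a b c where abc: "v = D \<phi> u a" "w = D \<phi> u b" "x = D \<phi> u c"
    using S unfolding tangent_space_eq[OF \<phi> u] by blast
  show "ext_deriv_real TYPE('d) M \<alpha> p (v + w) x = ext_deriv_real TYPE('d) M \<alpha> p v x + ext_deriv_real TYPE('d) M \<alpha> p w x"
    unfolding abc linear_add[OF \<phi>lin, symmetric] ext linear_add[OF 2] linear_add[OF 1] by simp
  show "ext_deriv_real TYPE('d) M \<alpha> p (r *\<^sub>R v) x = complex_of_real r * ext_deriv_real TYPE('d) M \<alpha> p v x"
    unfolding abc linear_scale[OF \<phi>lin, symmetric] ext linear_scale[OF 2] linear_scale[OF 1]
    by (simp add: scaleR_conv_of_real algebra_simps)
  show "ext_deriv_real TYPE('d) M \<alpha> p x v = - ext_deriv_real TYPE('d) M \<alpha> p v x"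
    unfolding abc ext by simp
qed

text \<open>Complex linearity in the first slot comes from real bilinearity in the chart, that in
  the second slot from skew-symmetry. Differentiability at \<open>u\<close> alone is assumed, which
  is what gets established for \<open>del_b\<close> and \<open>dbar_b\<close>.\<close>

lemma ext_deriv_bilinear:
  fixes \<phi> :: "real^'d \<Rightarrow> 'a::euclidean_space"
  assumes M: "smooth_submanifold TYPE('d::finite) M" and \<phi>: "local_parametrization M U \<phi>"
    and u: "u \<in> U" "\<phi> u = p" and chart: "chart_at TYPE('d) M p = (\<phi>, u)"
    and \<alpha>: "\<And>q. q \<in> M \<Longrightarrow> clinear_on (CT TYPE('d) M q) (\<alpha> q)"
    and diff: "\<And>b. pullback \<phi> \<alpha> b differentiable (at u)"
    and W: "W \<in> CT TYPE('d) M p"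
  shows "clinear_on (CT TYPE('d) M p) (\<lambda>V. ext_deriv TYPE('d) M \<alpha> p V W)"
    "clinear_on (CT TYPE('d) M p) (ext_deriv TYPE('d) M \<alpha> p W)"
proof -
  let ?S = "tangent_space TYPE('d) M p" and ?E = "ext_deriv_real TYPE('d) M \<alpha> p"
  have "p \<in> M" using local_parametrization_subset[OF \<phi>] u by auto
  then have S: "subspace ?S" by (rule subspace_tangent_space[OF M])
  note bil = ext_deriv_real_bilinear[OF M \<phi> u chart \<alpha> diff]
  have add: "?E (v + w) x = ?E v x + ?E w x" if "v \<in> ?S" "w \<in> ?S" "x \<in> ?S" for v w x
    using bil(1) that by blast
  have scale: "?E (r *\<^sub>R v) x = complex_of_real r * ?E v x" if "v \<in> ?S" "x \<in> ?S" for v x r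
    using bil(2)[of v v x r] that by blast
  have skew: "?E x v = - ?E v x" if "v \<in> ?S" "x \<in> ?S" for v x
    using bil(3)[of v v x] that by blast
  have diff: "?E (v - w) x = ?E v x - ?E w x" if "v \<in> ?S" "w \<in> ?S" "x \<in> ?S" for v w x
    using add[of v "- w" x] scale[of w x "-1"] that subspace_neg[OF S] by simp
  note mem = subspace_add[OF S] subspace_diff[OF S] subspace_scale[OF S]
  show 1: "clinear_on (CT TYPE('d) M p) (\<lambda>V. ext_deriv TYPE('d) M \<alpha> p V W)"
    using W unfolding clinear_on_def CT_def ext_deriv_def cscale_def
    by (auto simp: add diff scale mem complex_eq_iff algebra_simps)
  have "ext_deriv TYPE('d) M \<alpha> p W V = - ext_deriv TYPE('d) M \<alpha> p V W" if "V \<in> CT TYPE('d) M p" for V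
    using W that skew[of "fst V" "fst W"] skew[of "snd V" "fst W"] skew[of "fst V" "snd W"] skew[of "snd V" "snd W"]
    unfolding CT_def ext_deriv_def by (auto simp: algebra_simps)
  then show "clinear_on (CT TYPE('d) M p) (ext_deriv TYPE('d) M \<alpha> p W)"
    using 1 subspace_CT[OF S] unfolding clinear_on_def
    by (simp add: cvec.subspace_add cvec.subspace_scale)
qed

text \<open>On such pairs \<open>del_b1\<close> and \<open>dbar_b1\<close> thereby become plain
  exterior derivatives, and the frame disappears from the second-order operators as well.\<close>

lemma component11_ext_deriv:
  fixes \<phi> :: "real^'d \<Rightarrow> complex^'N"
  assumes M: "smooth_submanifold TYPE('d::finite) M" and \<phi>: "local_parametrization M U \<phi>"
    and u: "u \<in> U" "\<phi> u = p" and chart: "chart_at TYPE('d) M p = (\<phi>, u)"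
    and \<alpha>: "\<And>q. q \<in> M \<Longrightarrow> clinear_on (CT TYPE('d) M q) (\<alpha> q)"
    and diff: "\<And>b. pullback \<phi> \<alpha> b differentiable (at u)"
    and L: "L \<in> T10 TYPE('d) M p" "L' \<in> T10 TYPE('d) M p"
  shows "component11 TYPE('d) M (ext_deriv TYPE('d) M \<alpha>) p L (cconj L') = ext_deriv TYPE('d) M \<alpha> p L (cconj L')"
proof (rule component11_eq)
  have "p \<in> M" using local_parametrization_subset[OF \<phi>] u by auto
  then show S: "subspace (tangent_space TYPE('d) M p)" by (rule subspace_tangent_space[OF M])
  note bil = ext_deriv_bilinear[OF M \<phi> u chart \<alpha> diff]
  have CT: "K \<in> CT TYPE('d) M p \<and> cconj K \<in> CT TYPE('d) M p" if "K \<in> T10 TYPE('d) M p" for K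
    using that T10_subset_CT cconj_CT[OF S] by blast
  show "clinear_on (T10 TYPE('d) M p) (\<lambda>L. ext_deriv TYPE('d) M \<alpha> p L (cconj L'))"
    if "L' \<in> T10 TYPE('d) M p" for L'
    using bil(1)[of "cconj L'"] CT that T10_subset_CT unfolding clinear_on_def by blast
  have "clinear_on (CT TYPE('d) M p) (ext_deriv TYPE('d) M \<alpha> p L)"
    using bil(2)[of L] CT L(1) by blast
  then show "clinear_on (T10 TYPE('d) M p) (\<lambda>L'. cnj (ext_deriv TYPE('d) M \<alpha> p L (cconj L')))"
    using CT unfolding clinear_on_def by (simp add: cconj_add cconj_cscale)
qed (fact L)+

section \<open>The complex Hessian\<close>

definition hess :: "('a::real_normed_vector \<Rightarrow> real) \<Rightarrow> 'a \<Rightarrow> 'a \<Rightarrow> 'a \<Rightarrow> real" where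
  "hess h p v w = D (\<lambda>z. D h z v) p w"

lemma hess_commute: "smooth_on UNIV h \<Longrightarrow> hess h p v w = hess h p w v"
  unfolding hess_def by (rule D2_symmetric[of UNIV]) auto

lemma linear_hess_left: "smooth_on UNIV h \<Longrightarrow> linear (\<lambda>v. hess h p v w)"
  unfolding hess_def by (rule D2_linear[of UNIV]) auto

lemma linear_hess_right: "smooth_on UNIV h \<Longrightarrow> linear (hess h p v)"
  using hess_commute[of h p v] linear_hess_left[of h p v] by presburger

text \<open>Four times the complex Hessian, as a sesquilinear form.\<close>

definition complex_hess :: "(complex^'N \<Rightarrow> real) \<Rightarrow> complex^'N \<Rightarrow> complex^'N \<Rightarrow> complex^'N \<Rightarrow> complex" where
  "complex_hess h p v w =
     Complex (hess h p v w + hess h p (J v) (J w)) (hess h p v (J w) - hess h p (J v) w)"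

lemma D_complex_of_real:
  assumes "smooth_on UNIV h"
  shows "D (complex_of_real \<circ> h) p v = complex_of_real (D h p v)" "(complex_of_real \<circ> h) differentiable (at p)"
proof -
  have "((complex_of_real \<circ> h) has_derivative (\<lambda>v. complex_of_real (D h p v))) (at p)"
    unfolding comp_def by (intro has_derivative_of_real smooth_on_has_derivative[OF assms]) simp
  then show "D (complex_of_real \<circ> h) p v = complex_of_real (D h p v)" "(complex_of_real \<circ> h) differentiable (at p)"
    by (simp_all add: D_eqI differentiable_def exI)
qed

lemma linear_D_complex_of_real: "smooth_on UNIV h \<Longrightarrow> linear (D (complex_of_real \<circ> h) p)"
  using D_complex_of_real(2) frechet_derivative_works has_derivative_linear by blast

context
  fixes h :: "complex^'N \<Rightarrow> real"
  assumes h: "smooth_on UNIV h"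
begin

lemma complex_hess_cnj: "complex_hess h p w v = cnj (complex_hess h p v w)"
  by (simp add: complex_hess_def complex_eq_iff hess_commute[OF h])

lemma complex_hess_add_left: "complex_hess h p (v + v') w = complex_hess h p v w + complex_hess h p v' w"
  by (simp add: complex_hess_def complex_eq_iff J_add linear_add[OF linear_hess_left[OF h]])

text \<open>By real bilinearity only \<open>c = \<i>\<close> matters: replacing \<open>v\<close> by
  \<open>J v\<close> turns the real and imaginary parts by a quarter, because J squared is
  -1.\<close>

lemma complex_hess_scale_left: "complex_hess h p (c *s v) w = c * complex_hess h p v w"
proof -
  have "c *s v = Re c *\<^sub>R v + Im c *\<^sub>R J v"
    by (simp add: vec_eq_iff complex_eq_iff)
  moreover note l = linear_hess_left[OF h]
  ultimately show ?thesis
    by (simp add: complex_hess_def complex_eq_iff J_add J_scaleR linear_add[OF l] linear_scale[OF l] linear_diff[OF l]) (simp add: algebra_simps)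
qed

lemma complex_hess_sum_left: "complex_hess h p (\<Sum>a\<in>A. f a) w = (\<Sum>a\<in>A. complex_hess h p (f a) w)"
proof (induction A rule: infinite_finite_induct)
  case empty
  show ?case using complex_hess_scale_left[of p 0 0 w] by simp
qed (use complex_hess_scale_left[of p 0 0 w] in \<open>auto simp: complex_hess_add_left\<close>)

lemma complex_hess_sum_right: "complex_hess h p v (\<Sum>a\<in>A. f a) = (\<Sum>a\<in>A. complex_hess h p v (f a))"
  by (simp add: complex_hess_cnj[of p v] complex_hess_sum_left)

lemma complex_hess_scale_right: "complex_hess h p v (c *s w) = cnj c * complex_hess h p v w"
  by (simp add: complex_hess_cnj[of p v] complex_hess_scale_left)

text \<open>Each Wirtinger derivative contributes a factor 1/2, and \<open>axis i \<i>\<close> is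
  \<open>J\<close> applied to \<open>axis i 1\<close>.\<close>

lemma del_z_del_zbar:
  "del_z j (del_zbar k (complex_of_real \<circ> h)) z = complex_hess h z (axis j 1) (axis k 1) / 4"
proof -
  have J_axis: "J (axis i 1) = axis i \<i>" for i :: 'N by (simp add: vec_eq_iff axis_def)
  have "((\<lambda>z. D h z v) has_derivative hess h z v) (at z)" for v
    using smooth_on_has_derivative[OF smooth_on_D[OF h, of v], of z] by (simp add: hess_def[abs_def])
  then have "((\<lambda>z. (complex_of_real (D h z (axis k 1)) + \<i> * complex_of_real (D h z (axis k \<i>))) / 2) has_derivative
     (\<lambda>v. (complex_of_real (hess h z (axis k 1) v) + \<i> * complex_of_real (hess h z (axis k \<i>) v)) / 2)) (at z)"
    by (auto intro!: derivative_eq_intros)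
  then have "D (del_zbar k (complex_of_real \<circ> h)) z =
     (\<lambda>v. (complex_of_real (hess h z (axis k 1) v) + \<i> * complex_of_real (hess h z (axis k \<i>) v)) / 2)"
    unfolding del_zbar_def[abs_def] D_complex_of_real(1)[OF h] by (rule D_eqI)
  then show ?thesis
    by (simp add: del_z_def complex_hess_def J_axis complex_eq_iff hess_commute[OF h, of z "axis k _"] field_simps)
qed

text \<open>Carries positivity of the coordinate Hessian in \<open>strongly_psh\<close> over to the
  form \<open>complex_hess\<close>, which is written with \<open>J\<close> only and so can be
  compared with derivatives on \<open>M\<close>.\<close>

lemma complex_hess_expansion:
  "(\<Sum>j\<in>UNIV. \<Sum>k\<in>UNIV. del_z j (del_zbar k (complex_of_real \<circ> h)) z * \<xi> $ j * cnj (\<eta> $ k)) = complex_hess h z \<xi> \<eta> / 4"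
proof -
  have "complex_hess h z \<xi> \<eta> = complex_hess h z (\<Sum>j\<in>UNIV. \<xi> $ j *s axis j 1) (\<Sum>k\<in>UNIV. \<eta> $ k *s axis k 1)"
    by (simp only: basis_expansion)
  also have "\<dots> = (\<Sum>j\<in>UNIV. \<Sum>k\<in>UNIV. complex_hess h z (axis j 1) (axis k 1) * \<xi> $ j * cnj (\<eta> $ k))"
    unfolding complex_hess_sum_left complex_hess_scale_left
    unfolding complex_hess_sum_right complex_hess_scale_right
    by (simp add: sum_distrib_left mult_ac)
  finally show ?thesis by (simp add: del_z_del_zbar sum_divide_distrib)
qed

lemma strongly_psh_complex_hess_pos:
  assumes "strongly_psh h" "\<xi> \<noteq> 0"
  shows "0 < Re (complex_hess h z \<xi> \<xi>)"
  using assms unfolding strongly_psh_def positive_definite_on_def complex_hess_expansion by auto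

end

section \<open>The complex Hessian and the Levi form\<close>

context
  fixes M :: "(complex^'N) set" and \<gamma> :: "(complex^'N) form1"
    and T :: "complex^'N \<Rightarrow> (complex^'N) \<times> (complex^'N)" and h :: "complex^'N \<Rightarrow> real"
    and \<phi> :: "real^'d::finite \<Rightarrow> complex^'N" and U u
  assumes M: "smooth_submanifold TYPE('d) M" and char: "characteristic_form TYPE('d) M \<gamma> T"
    and h: "smooth_on UNIV h" and \<phi>: "local_parametrization M U \<phi>" and u: "u \<in> U"
begin

lemma chart_has_derivative:
  shows "(\<phi> has_derivative D \<phi> u) (at u)" "((\<lambda>y. D \<phi> y b) has_derivative D (\<lambda>y. D \<phi> y b) u) (at u)"
    "D (\<lambda>y. D \<phi> y b) u a = D (\<lambda>y. D \<phi> y a) u b"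
proof -
  have s: "smooth_on U \<phi>" and U: "open U" using \<phi> unfolding local_parametrization_def by auto
  show "(\<phi> has_derivative D \<phi> u) (at u)" by (rule smooth_on_has_derivative[OF s u])
  show "((\<lambda>y. D \<phi> y b) has_derivative D (\<lambda>y. D \<phi> y b) u) (at u)"
    by (rule smooth_on_has_derivative[OF smooth_on_D[OF s] u])
  show "D (\<lambda>y. D \<phi> y b) u a = D (\<lambda>y. D \<phi> y a) u b" by (rule D2_symmetric[OF s U u])
qed

lemma chart_point: "y \<in> U \<Longrightarrow> \<phi> y \<in> M"
  using local_parametrization_subset[OF \<phi>] by blast

text \<open>\<open>G\<close> represents the real form - \<i> \<gamma>. It is needed on all of
  \<open>U\<close>, as the formula for \<open>del_b\<close> must hold near \<open>u\<close> before
  being differentiated there.\<close>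

lemma characteristic_representer:
  obtains G where "\<And>y. y \<in> U \<Longrightarrow> G y \<in> tangent_space TYPE('d) M (\<phi> y)"
    "\<And>y v. y \<in> U \<Longrightarrow> v \<in> tangent_space TYPE('d) M (\<phi> y) \<Longrightarrow> v \<bullet> G y = Im (\<gamma> (\<phi> y) (v, 0))"
    "G differentiable (at u)"
proof -
  have smooth: "smooth_form1 TYPE('d) M \<gamma>" using char by (simp add: characteristic_form_def)
  have lin: "linear (\<lambda>b. Im (pullback \<phi> \<gamma> b y))" if y: "y \<in> U" for y
  proof -
    have "linear (\<lambda>b. pullback \<phi> \<gamma> b y)"
      using smooth chart_point[OF y] by (intro pullback_linear[OF M \<phi> y]) (simp add: smooth_form1_def)
    from linear_add[OF this] linear_scale[OF this] show ?thesis by (intro linearI) simp_all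
  qed
  have "pullback \<phi> \<gamma> b differentiable (at u)" for b
    using smooth \<phi> smooth_on_differentiable[OF _ u] unfolding smooth_form1_def by blast
  then have d\<gamma>: "(\<lambda>y. Im (pullback \<phi> \<gamma> b y)) differentiable (at u)" for b
    unfolding differentiable_def by (blast intro: has_derivative_Im)
  have d\<phi>: "(\<lambda>y. D \<phi> y b) differentiable (at u)" for b
    using chart_has_derivative(2)[of b] unfolding differentiable_def by blast
  have inj: "inj (D \<phi> y)" if "y \<in> U" for y using \<phi> that unfolding local_parametrization_def by blast
  obtain G where G: "\<And>y. y \<in> U \<Longrightarrow> G y \<in> range (D \<phi> y)"
    "\<And>y b. y \<in> U \<Longrightarrow> D \<phi> y b \<bullet> G y = Im (pullback \<phi> \<gamma> b y)" "G differentiable (at u)"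
    using riesz_representer_differentiable[OF local_parametrization_linear[OF \<phi>] inj lin d\<phi> d\<gamma> u] by blast
  show thesis
  proof (rule that[OF _ _ G(3)])
    fix y assume y: "y \<in> U"
    note TS = tangent_space_eq[OF \<phi> y refl]
    show "G y \<in> tangent_space TYPE('d) M (\<phi> y)" unfolding TS by (rule G(1)[OF y])
    show "v \<bullet> G y = Im (\<gamma> (\<phi> y) (v, 0))" if "v \<in> tangent_space TYPE('d) M (\<phi> y)" for v
      using that G(2)[OF y] unfolding TS pullback_def by blast
  qed
qed

text \<open>In the chart \<open>(dbar_b h - del_b h) / 2\<close> pulls back to \<open>(\<i> / 2) * R\<close>, where
  \<open>R b = D h (J b) - \<kappa> * (b \<bullet> G)\<close>; here \<open>G\<close> represents the real form \<open>- \<i> \<gamma>\<close>, and \<open>\<kappa>\<close> makes \<open>R\<close>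
  vanish on \<open>G\<close>.\<close>

lemma tangential_derivatives_in_chart:
  assumes chart: "chart_at TYPE('d) M (\<phi> u) = (\<phi>, u)"
  obtains \<kappa> :: real and G where
    "\<kappa> = D h (\<phi> u) (J G) / (G \<bullet> G)" "1 \<le> norm (T (\<phi> u)) * norm G"
    "\<And>b. pullback \<phi> (del_b TYPE('d) M (complex_of_real \<circ> h)) b differentiable (at u)"
    "\<And>b. pullback \<phi> (dbar_b TYPE('d) M (complex_of_real \<circ> h)) b differentiable (at u)"
    "\<And>v w. \<lbrakk>v \<in> tangent_space TYPE('d) M (\<phi> u); w \<in> tangent_space TYPE('d) M (\<phi> u);
        \<gamma> (\<phi> u) (v, 0) = 0; \<gamma> (\<phi> u) (w, 0) = 0\<rbrakk> \<Longrightarrow>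
      ext_deriv_real TYPE('d) M (dbar_b TYPE('d) M (complex_of_real \<circ> h)) (\<phi> u) v w -
      ext_deriv_real TYPE('d) M (del_b TYPE('d) M (complex_of_real \<circ> h)) (\<phi> u) v w =
      \<i> * complex_of_real (hess h (\<phi> u) v (J w) - hess h (\<phi> u) (J v) w) -
      complex_of_real \<kappa> * ext_deriv_real TYPE('d) M \<gamma> (\<phi> u) v w"
proof -
  let ?h = "complex_of_real \<circ> h"
  have U: "open U" and inj: "inj (D \<phi> u)" using \<phi> u unfolding local_parametrization_def by auto
  obtain G where G: "\<And>y. y \<in> U \<Longrightarrow> G y \<in> tangent_space TYPE('d) M (\<phi> y)"
    "\<And>y v. y \<in> U \<Longrightarrow> v \<in> tangent_space TYPE('d) M (\<phi> y) \<Longrightarrow> v \<bullet> G y = Im (\<gamma> (\<phi> y) (v, 0))"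
    "G differentiable (at u)" using characteristic_representer by blast
  have S: "subspace (tangent_space TYPE('d) M (\<phi> y))" if "y \<in> U" for y
    by (rule subspace_tangent_space[OF M chart_point[OF that]])
  have TS: "D \<phi> y b \<in> tangent_space TYPE('d) M (\<phi> y)" if "y \<in> U" for y b
    unfolding tangent_space_eq[OF \<phi> that refl] by blast
  note facts = char chart_point S G(1,2)
  have norm_G: "1 \<le> norm (T (\<phi> u)) * norm (G u)"
    by (rule representer_norm_ge[OF facts]) (use u in auto)
  have G0: "G u \<noteq> 0" using norm_G by auto
  define s where "s b y = D \<phi> y b \<bullet> G y" for b y
  define \<kappa> where "\<kappa> y = D h (\<phi> y) (J (G y)) / (G y \<bullet> G y)" for y
  \<comment> \<open>The counterpart of \<open>\<kappa>\<close> without \<open>J\<close>. It occurs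
    only in \<open>P\<close>, which cancels between \<open>dbar_b\<close> and \<open>del_b\<close>,
    so nothing beyond its differentiability is used.\<close>
  define \<kappa>' where "\<kappa>' y = D h (\<phi> y) (G y) / (G y \<bullet> G y)" for y
  define R where "R b y = D h (\<phi> y) (J (D \<phi> y b)) - s b y * \<kappa> y" for b y
  define P where "P b y = D h (\<phi> y) (D \<phi> y b) - s b y * \<kappa>' y" for b y
  have del: "pullback \<phi> (del_b TYPE('d) M ?h) b y = (complex_of_real (P b y) - \<i> * complex_of_real (R b y)) / 2"
    if y: "y \<in> U" for b y
  proof -
    have "pullback \<phi> (del_b TYPE('d) M ?h) b y =
      (D ?h (\<phi> y) (D \<phi> y b - ((D \<phi> y b \<bullet> G y) / (G y \<bullet> G y)) *\<^sub>R G y) -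
       \<i> * D ?h (\<phi> y) (J (D \<phi> y b - ((D \<phi> y b \<bullet> G y) / (G y \<bullet> G y)) *\<^sub>R G y))) / 2"
      unfolding pullback_def
      by (rule del_b_real_vector[OF facts]) (use y TS linear_D_complex_of_real[OF h] in auto)
    moreover have l: "linear (D h (\<phi> y))" using smooth_on_linear_D[OF h] by blast
    ultimately show ?thesis
      by (simp add: D_complex_of_real(1)[OF h] P_def R_def s_def \<kappa>_def \<kappa>'_def J_diff J_scaleR linear_diff[OF l] linear_scale[OF l])
  qed
  have dbar: "pullback \<phi> (dbar_b TYPE('d) M ?h) b y = (complex_of_real (P b y) + \<i> * complex_of_real (R b y)) / 2"
    if y: "y \<in> U" for b y
  proof -
    have "pullback \<phi> (dbar_b TYPE('d) M ?h) b y = cnj (pullback \<phi> (del_b TYPE('d) M ?h) b y)"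
      by (simp add: pullback_def cconj_def dbar_b_eq_cnj[OF D_complex_of_real(1)[OF h] smooth_on_linear_D[OF h UNIV_I]])
    then show ?thesis unfolding del[OF y] by simp
  qed
  have gam: "pullback \<phi> \<gamma> b y = \<i> * complex_of_real (s b y)" if y: "y \<in> U" for b y
    unfolding pullback_def s_def
    by (rule characteristic_form_real[OF facts]) (use y TS in auto)

  note along = has_derivative_D_along[OF h open_UNIV UNIV_I chart_has_derivative(1)]
  obtain G' where G': "(G has_derivative G') (at u)" using G(3) unfolding differentiable_def by blast
  have J': "((\<lambda>y. J (f y)) has_derivative (\<lambda>a. J (f' a))) (at u)" if "(f has_derivative f') (at u)"
    for f :: "real^'d \<Rightarrow> complex^'N" and f'
    using that by (rule bounded_linear.has_derivative[OF linear_J[unfolded linear_conv_bounded_linear]])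
  have s': "(s b has_derivative D (s b) u) (at u)" for b
    unfolding s_def[abs_def] frechet_derivative_works[symmetric]
    using chart_has_derivative(2)[of b] G(3) by (intro differentiable_inner) (auto simp: differentiable_def)
  have "\<kappa> differentiable (at u)" "\<kappa>' differentiable (at u)"
    unfolding \<kappa>_def[abs_def] \<kappa>'_def[abs_def]
    by (intro differentiable_divide differentiable_inner G(3)
        differentiableI[OF along[OF G']] differentiableI[OF along[OF J'[OF G']]]; simp add: G0)+
  then have \<kappa>_deriv: "(\<kappa> has_derivative D \<kappa> u) (at u)" "(\<kappa>' has_derivative D \<kappa>' u) (at u)"
    by (simp_all add: frechet_derivative_works)
  have P': "(P b has_derivative D (P b) u) (at u)" for b
    unfolding P_def[abs_def] frechet_derivative_works[symmetric]
    using along[OF chart_has_derivative(2)[of b]] s'[of b] \<kappa>_deriv(2)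
    by (intro differentiable_diff differentiable_mult) (auto simp: differentiable_def)
  have R': "(R b has_derivative (\<lambda>a. D h (\<phi> u) (J (D (\<lambda>y. D \<phi> y b) u a)) + hess h (\<phi> u) (J (D \<phi> u b)) (D \<phi> u a) -
      (s b u * D \<kappa> u a + D (s b) u a * \<kappa> u))) (at u)" for b
    unfolding R_def[abs_def] hess_def
    by (intro has_derivative_diff has_derivative_mult s' \<kappa>_deriv along[OF J'[OF chart_has_derivative(2)]])
  \<comment> \<open>The frame-free formula holds on all of \<open>U\<close>; so the coefficient
    inherits its derivative from \<open>P\<close> and \<open>R\<close>, although the frames need not
    vary continuously.\<close>
  have del': "(pullback \<phi> (del_b TYPE('d) M ?h) b has_derivative
      (\<lambda>a. (complex_of_real (D (P b) u a) - \<i> * complex_of_real (D (R b) u a)) / 2)) (at u)" for b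
    by (rule has_derivative_transform_within_open[OF _ U u del[symmetric]])
      (use P'[of b] R'[of b] D_eqI[OF R'[of b]] in \<open>auto intro!: derivative_eq_intros\<close>)
  have dbar': "(pullback \<phi> (dbar_b TYPE('d) M ?h) b has_derivative
      (\<lambda>a. (complex_of_real (D (P b) u a) + \<i> * complex_of_real (D (R b) u a)) / 2)) (at u)" for b
    by (rule has_derivative_transform_within_open[OF _ U u dbar[symmetric]])
      (use P'[of b] R'[of b] D_eqI[OF R'[of b]] in \<open>auto intro!: derivative_eq_intros\<close>)
  have gam': "(pullback \<phi> \<gamma> b has_derivative (\<lambda>a. \<i> * complex_of_real (D (s b) u a))) (at u)" for b
    by (rule has_derivative_transform_within_open[OF _ U u gam[symmetric]])
      (use s'[of b] in \<open>auto intro!: derivative_eq_intros\<close>)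
  note ext = ext_deriv_real_chart[OF chart inj]
  show thesis
  proof (rule that[of "\<kappa> u" "G u"])
    show "\<kappa> u = D h (\<phi> u) (J (G u)) / (G u \<bullet> G u)" by (simp add: \<kappa>_def)
    show "pullback \<phi> (del_b TYPE('d) M ?h) b differentiable (at u)"
      "pullback \<phi> (dbar_b TYPE('d) M ?h) b differentiable (at u)" for b
      using del' dbar' unfolding differentiable_def by blast+
    fix v w assume v: "v \<in> tangent_space TYPE('d) M (\<phi> u)" "\<gamma> (\<phi> u) (v, 0) = 0"
      and w: "w \<in> tangent_space TYPE('d) M (\<phi> u)" "\<gamma> (\<phi> u) (w, 0) = 0"
    obtain a b where ab: "v = D \<phi> u a" "w = D \<phi> u b"
      using v(1) w(1) unfolding tangent_space_eq[OF \<phi> u refl] by blast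
    \<comment> \<open>\<open>s a\<close> and \<open>s b\<close> vanish at \<open>u\<close> but not
      necessarily near it. In the product rule the derivatives of \<open>\<kappa>\<close> drop out,
      while those of \<open>s\<close> remain and form d\<gamma>.\<close>
    have s0: "s a u = 0" "s b u = 0"
      using v w G(2)[OF u] unfolding ab s_def by auto
    have "ext_deriv_real TYPE('d) M (dbar_b TYPE('d) M ?h) (\<phi> u) v w -
        ext_deriv_real TYPE('d) M (del_b TYPE('d) M ?h) (\<phi> u) v w =
        \<i> * complex_of_real (D (R b) u a - D (R a) u b)"
      unfolding ab ext D_eqI[OF del'] D_eqI[OF dbar'] by (simp add: algebra_simps field_simps)
    \<comment> \<open>The second derivatives of the chart are symmetric and cancel, leaving ambient
      second derivatives of \<open>h\<close>.\<close>
    also have "D (R b) u a - D (R a) u b = hess h (\<phi> u) (J w) v - hess h (\<phi> u) (J v) w - \<kappa> u * (D (s b) u a - D (s a) u b)"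
      unfolding D_eqI[OF R'] ab by (simp add: s0 chart_has_derivative(3)[of b a] algebra_simps)
    also have "\<i> * complex_of_real \<dots> =
        \<i> * complex_of_real (hess h (\<phi> u) v (J w) - hess h (\<phi> u) (J v) w) -
        complex_of_real (\<kappa> u) * ext_deriv_real TYPE('d) M \<gamma> (\<phi> u) v w"
      unfolding ab ext D_eqI[OF gam'] by (simp add: hess_commute[OF h, of _ "J (D \<phi> u b)"] algebra_simps)
    finally show "ext_deriv_real TYPE('d) M (dbar_b TYPE('d) M ?h) (\<phi> u) v w -
        ext_deriv_real TYPE('d) M (del_b TYPE('d) M ?h) (\<phi> u) v w =
        \<i> * complex_of_real (hess h (\<phi> u) v (J w) - hess h (\<phi> u) (J v) w) -
        complex_of_real (\<kappa> u) * ext_deriv_real TYPE('d) M \<gamma> (\<phi> u) v w" .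
  qed (fact norm_G)
qed

end

lemma clinear_on_dbar_b:
  assumes S: "subspace (tangent_space d M p)" and h: "smooth_on UNIV h"
  shows "clinear_on (CT d M p) (dbar_b d M (complex_of_real \<circ> h) p)"
proof -
  have "dbar_b d M (complex_of_real \<circ> h) p = (\<lambda>V. cnj (del_b d M (complex_of_real \<circ> h) p (cconj V)))"
    by (simp add: fun_eq_iff dbar_b_eq_cnj[OF D_complex_of_real(1)[OF h] smooth_on_linear_D[OF h UNIV_I]])
  then show ?thesis
    using clinear_on_del_b[OF S, of "complex_of_real \<circ> h"] cconj_CT[OF S]
    unfolding clinear_on_def by (simp add: cconj_add cconj_cscale)
qed

text \<open>\<gamma> annihilates both \<open>L\<close> and \<open>cconj L\<close>, hence their sum
  and difference. This makes the chart formula, valid for real vectors in the kernel of \<gamma>,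
  applicable to both components of \<open>L\<close>.\<close>

lemma characteristic_form_real_parts_T10:
  assumes char: "characteristic_form d M \<gamma> T" and p: "p \<in> M" and S: "subspace (tangent_space d M p)"
    and L: "L \<in> T10 d M p"
  shows "\<gamma> p (fst L, 0) = 0" "\<gamma> p (snd L, 0) = 0"
proof -
  have L': "cconj L \<in> T01 d M p" using L by (simp add: T01_def)
  have 0: "\<gamma> p L = 0" "\<gamma> p (cconj L) = 0"
    using char p L L' unfolding characteristic_form_def by blast+
  note lin = clinear_on_characteristic_form[OF char p S]
  have CT: "L \<in> CT d M p" "cconj L \<in> CT d M p" "(snd L, 0) \<in> CT d M p"
    using L L' T10_subset_CT T01_subset_CT[OF S] real_vector_CT[OF char p S T10_D(3)[OF L]] by blast+
  have "\<gamma> p (- snd L, 0) = - \<gamma> p (snd L, 0)"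
    using clinear_on_cscale[OF lin CT(3), of "-1"] by (simp add: cscale_def)
  then show "\<gamma> p (fst L, 0) = 0" "\<gamma> p (snd L, 0) = 0"
    using clinear_on_CT_split[OF char p S lin CT(1)] clinear_on_CT_split[OF char p S lin CT(2)] 0
    by (auto simp: cconj_def complex_eq_iff)
qed

text \<open>With L = X - \<i>JX and cconj L' = Y + \<i>JY, the complex bilinear extension uses the
  real formula on four pairs. By symmetry of \<open>hess\<close> and J squared = -1 the four terms
  combine to \<open>2 * complex_hess\<close>, and the final division by 2 removes the
  factor.\<close>

lemma CR_hessian_eq:
  fixes M :: "(complex^'N) set"
  assumes M: "smooth_submanifold TYPE('d::finite) M" and char: "characteristic_form TYPE('d) M \<gamma> T"
    and h: "smooth_on UNIV h" and p: "p \<in> M"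
    and C: "C \<ge> 0" "\<And>v. \<bar>D h p v\<bar> \<le> C * norm v"
  obtains \<kappa> :: real where "\<bar>\<kappa>\<bar> \<le> C * norm (T p)"
    "\<And>L L'. \<lbrakk>L \<in> T10 TYPE('d) M p; L' \<in> T10 TYPE('d) M p\<rbrakk> \<Longrightarrow>
       (del_b1 TYPE('d) M (dbar_b TYPE('d) M (complex_of_real \<circ> h)) p L (cconj L') -
        dbar_b1 TYPE('d) M (del_b TYPE('d) M (complex_of_real \<circ> h)) p L (cconj L')) / 2 =
       complex_hess h p (fst L) (fst L') - complex_of_real (\<kappa> / 2) * levi_form TYPE('d) M \<gamma> p L L'"
proof -
  obtain \<phi> :: "real^'d \<Rightarrow> complex^'N" and u where chart: "chart_at TYPE('d) M p = (\<phi>, u)" by fastforce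
  obtain U where \<phi>: "local_parametrization M U \<phi>" and u: "u \<in> U" "\<phi> u = p"
    by (rule chart_at_correct[OF M p chart])
  have S: "subspace (tangent_space TYPE('d) M q)" if "q \<in> M" for q by (rule subspace_tangent_space[OF M that])
  let ?del = "del_b TYPE('d) M (complex_of_real \<circ> h)" and ?dbar = "dbar_b TYPE('d) M (complex_of_real \<circ> h)"
  let ?E = "ext_deriv_real TYPE('d) M"
  obtain \<kappa> G where \<kappa>: "\<kappa> = D h p (J G) / (G \<bullet> G)" and G: "1 \<le> norm (T p) * norm G"
    and diff: "\<And>b. pullback \<phi> ?del b differentiable (at u)" "\<And>b. pullback \<phi> ?dbar b differentiable (at u)"
    and ext: "\<And>v w. \<lbrakk>v \<in> tangent_space TYPE('d) M p; w \<in> tangent_space TYPE('d) M p;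
        \<gamma> p (v, 0) = 0; \<gamma> p (w, 0) = 0\<rbrakk> \<Longrightarrow>
      ?E ?dbar p v w - ?E ?del p v w =
      \<i> * complex_of_real (hess h p v (J w) - hess h p (J v) w) - complex_of_real \<kappa> * ?E \<gamma> p v w"
    using tangential_derivatives_in_chart[OF M char h \<phi> u(1), unfolded u(2), OF chart] by metis
  show thesis
  proof (rule that[of \<kappa>])
    have G0: "norm G > 0" using G by (auto simp: less_le)
    \<comment> \<open>As \<open>J\<close> is an isometry, |\<kappa>| |G| is at most
      \<open>C\<close>; multiplying \<open>C\<close> by |T| |G|, which is at least 1, lets |G|
      cancel.\<close>
    have "\<bar>\<kappa>\<bar> * norm G * norm G = \<bar>D h p (J G)\<bar>"
      using G0 by (simp add: \<kappa> abs_mult dot_square_norm power2_eq_square)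
    also have "\<dots> \<le> C * norm G" using C(2)[of "J G"] by (simp add: norm_J)
    finally have "\<bar>\<kappa>\<bar> * norm G \<le> C" using G0 by simp
    also have "\<dots> \<le> C * (norm (T p) * norm G)" using G C(1) by (simp add: mult_left_mono[of 1, simplified] mult_le_cancel_left1)
    finally show "\<bar>\<kappa>\<bar> \<le> C * norm (T p)" using G0 by (simp flip: mult.assoc)
  next
    fix L L' assume L: "L \<in> T10 TYPE('d) M p" "L' \<in> T10 TYPE('d) M p"
    let ?X = "fst L" and ?Y = "fst L'"
    note T = T10_D[OF L(1)] T10_D[OF L(2)]
    note par = characteristic_form_real_parts_T10[OF char p S[OF p] L(1)] characteristic_form_real_parts_T10[OF char p S[OF p] L(2)]
    \<comment> \<open>The imaginary part of \<open>L'\<close> is \<open>- J ?Y\<close>, so tangency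
      and vanishing of \<gamma> are known up to sign; \<open>cconj L'\<close> needs them for
      \<open>J ?Y\<close>.\<close>
    have JY: "J ?Y \<in> tangent_space TYPE('d) M p" "\<gamma> p (J ?Y, 0) = 0"
    proof -
      show "J ?Y \<in> tangent_space TYPE('d) M p" using subspace_neg[OF S[OF p] T(6)] T(5) by simp
      show "\<gamma> p (J ?Y, 0) = 0"
        using clinear_on_cscale[OF clinear_on_characteristic_form[OF char p S[OF p]] real_vector_CT[OF char p S[OF p] T(6)], of "-1"] par(4) T(5)
        by (simp add: cscale_def)
    qed
    have e: "ext_deriv TYPE('d) M ?dbar p L (cconj L') - ext_deriv TYPE('d) M ?del p L (cconj L') =
      (?E ?dbar p ?X ?Y - ?E ?del p ?X ?Y) - (?E ?dbar p (snd L) (J ?Y) - ?E ?del p (snd L) (J ?Y)) +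
      \<i> * ((?E ?dbar p ?X (J ?Y) - ?E ?del p ?X (J ?Y)) + (?E ?dbar p (snd L) ?Y - ?E ?del p (snd L) ?Y))"
      using T(5) by (simp add: ext_deriv_def cconj_def algebra_simps)
    have l: "ext_deriv TYPE('d) M \<gamma> p L (cconj L') =
      ?E \<gamma> p ?X ?Y - ?E \<gamma> p (snd L) (J ?Y) + \<i> * (?E \<gamma> p ?X (J ?Y) + ?E \<gamma> p (snd L) ?Y)"
      using T(5) by (simp add: ext_deriv_def cconj_def)
    have "ext_deriv TYPE('d) M ?dbar p L (cconj L') - ext_deriv TYPE('d) M ?del p L (cconj L') =
      2 * complex_hess h p ?X ?Y - complex_of_real \<kappa> * ext_deriv TYPE('d) M \<gamma> p L (cconj L')"
      unfolding e l ext[OF T(1) T(4) par(1,3)] ext[OF T(3) JY(1) par(2) JY(2)]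
        ext[OF T(1) JY(1) par(1) JY(2)] ext[OF T(3) T(4) par(2,3)]
      unfolding T(2)
      using linear_neg[OF linear_hess_left[OF h]] linear_neg[OF linear_hess_right[OF h]]
      by (simp add: complex_hess_def complex_eq_iff J_minus algebra_simps)
    moreover have "del_b1 TYPE('d) M ?dbar p L (cconj L') = ext_deriv TYPE('d) M ?dbar p L (cconj L')"
      unfolding del_b1_def
      by (rule component11_ext_deriv[OF M \<phi> u chart clinear_on_dbar_b[OF S h] diff(2) L])
    moreover have "dbar_b1 TYPE('d) M ?del p L (cconj L') = ext_deriv TYPE('d) M ?del p L (cconj L')"
      unfolding dbar_b1_def
      by (rule component11_ext_deriv[OF M \<phi> u chart clinear_on_del_b[OF S] diff(1) L])
    ultimately show "(del_b1 TYPE('d) M ?dbar p L (cconj L') - dbar_b1 TYPE('d) M ?del p L (cconj L')) / 2 =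
       complex_hess h p ?X ?Y - complex_of_real (\<kappa> / 2) * levi_form TYPE('d) M \<gamma> p L L'"
      by (simp add: levi_form_def)
  qed
qed

theorem lemma3p4:
  fixes M :: "(complex^'N) set" and n :: nat
    and \<gamma> :: "(complex^'N) form1" and h :: "complex^'N \<Rightarrow> real"
  assumes "n \<ge> 1" and "CARD('N) \<ge> n"
    and "CR_submanifold TYPE('d::finite) n M"
    and "compact M"
    and "orientable TYPE('d) M"
    and "pseudoconvex_form TYPE('d) M \<gamma>"
    and "smooth_on UNIV h"
    and "strongly_psh h"
  shows "strongly_CR_psh TYPE('d) M \<gamma> h"
proof -
  note h = assms(7)
  have M: "smooth_submanifold TYPE('d) M" using assms(3) by (simp add: CR_submanifold_def)
  obtain T where char: "characteristic_form TYPE('d) M \<gamma> T"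
    and levi: "\<And>p. p \<in> M \<Longrightarrow> positive_semidefinite_on (T10 TYPE('d) M p) (levi_form TYPE('d) M \<gamma> p)"
    using assms(6) unfolding pseudoconvex_form_def by blast
  obtain C where C: "C \<ge> 0" "\<And>p v. p \<in> M \<Longrightarrow> \<bar>D h p v\<bar> \<le> C * norm v"
    using D_bounded_on_compact[OF h assms(4)] by blast
  have "continuous_on M T"
    using char by (intro smooth_vector_field_continuous_on[OF M]) (simp add: characteristic_form_def)
  then have "bounded (T ` M)" by (intro compact_imp_bounded compact_continuous_image assms(4))
  then obtain K where K: "K > 0" "\<And>p. p \<in> M \<Longrightarrow> norm (T p) \<le> K" unfolding bounded_pos by blast
  \<comment> \<open>At every point |\<kappa>| is at most \<open>C * K\<close>, so
    \<open>A - \<kappa> / 2\<close> is nonnegative and the Levi form enters with a nonnegative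
    factor. The summand 1 makes \<open>A\<close> positive even when \<open>C = 0\<close>.\<close>
  define A where "A = C * K + 1"
  have A: "A > 0" using C(1) K(1) by (simp add: A_def add_nonneg_pos)
  let ?H = "\<lambda>p L L'. (del_b1 TYPE('d) M (dbar_b TYPE('d) M (complex_of_real \<circ> h)) p L (cconj L') -
           dbar_b1 TYPE('d) M (del_b TYPE('d) M (complex_of_real \<circ> h)) p L (cconj L')) / 2 +
          complex_of_real A * ext_deriv TYPE('d) M \<gamma> p L (cconj L')"
  have "positive_definite_on (T10 TYPE('d) M p) (?H p)" if p: "p \<in> M" for p
  proof -
    obtain \<kappa> where \<kappa>: "\<bar>\<kappa>\<bar> \<le> C * norm (T p)"
      "\<And>L L'. \<lbrakk>L \<in> T10 TYPE('d) M p; L' \<in> T10 TYPE('d) M p\<rbrakk> \<Longrightarrow>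
       (del_b1 TYPE('d) M (dbar_b TYPE('d) M (complex_of_real \<circ> h)) p L (cconj L') -
        dbar_b1 TYPE('d) M (del_b TYPE('d) M (complex_of_real \<circ> h)) p L (cconj L')) / 2 =
       complex_hess h p (fst L) (fst L') - complex_of_real (\<kappa> / 2) * levi_form TYPE('d) M \<gamma> p L L'"
      using CR_hessian_eq[OF M char h p C(1) C(2)[OF p]] by blast
    have H: "?H p L L' = complex_hess h p (fst L) (fst L') + complex_of_real (A - \<kappa> / 2) * levi_form TYPE('d) M \<gamma> p L L'"
      if "L \<in> T10 TYPE('d) M p" "L' \<in> T10 TYPE('d) M p" for L L'
      unfolding \<kappa>(2)[OF that] by (simp add: levi_form_def algebra_simps)
    have "C * norm (T p) \<le> C * K" using K(2)[OF p] C(1) by (rule mult_left_mono)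
    then have A\<kappa>: "A - \<kappa> / 2 \<ge> 0" using \<kappa>(1) C(1) K(1) by (simp add: A_def abs_le_iff)
    show ?thesis
      unfolding positive_definite_on_def hermitian_form_on_def
    proof (intro conjI ballI impI)
      fix L L' assume L: "L \<in> T10 TYPE('d) M p" "L' \<in> T10 TYPE('d) M p"
      have "levi_form TYPE('d) M \<gamma> p L' L = cnj (levi_form TYPE('d) M \<gamma> p L L')"
        using levi[OF p] L unfolding positive_semidefinite_on_def hermitian_form_on_def by blast
      then show "?H p L' L = cnj (?H p L L')"
        unfolding H[OF L] H[OF L(2,1)] using complex_hess_cnj[OF h, of p "fst L'" "fst L"] by simp
    next
      fix L assume L: "L \<in> T10 TYPE('d) M p" "L \<noteq> 0"
      have "fst L \<noteq> 0" using T10_D(2)[OF L(1)] L(2) by (auto simp: prod_eq_iff)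
      from strongly_psh_complex_hess_pos[OF h assms(8) this]
      have "0 < Re (complex_hess h p (fst L) (fst L))" .
      moreover have "0 \<le> Re (levi_form TYPE('d) M \<gamma> p L L)"
        using levi[OF p] L(1) unfolding positive_semidefinite_on_def by blast
      then have "0 \<le> (A - \<kappa> / 2) * Re (levi_form TYPE('d) M \<gamma> p L L)" using A\<kappa> by simp
      ultimately show "0 < Re (?H p L L)" unfolding H[OF L(1,1)] by simp
    qed
  qed
  then show ?thesis
    unfolding strongly_CR_psh_def using A h open_UNIV by blast
qed

end
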